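(* Let $\epsilon>0$ and $t>0$ be real numbers and let $(k_n)_n$ be a sequence of positive numbers. Then, for a vertex $x$ of $\{1,\dots,n\}$, as $n\to+\infty$, $$\mathbb{P}\big(|C^{(n)}_{nt}(x)|\le k_n\big)-\mathbb{P}\big(T^{(1)}_{\epsilon,t}\le k_n\big)=O\Big(\frac{k_n^2}{n}\Big).$$
   Context: Model. Fix $\epsilon>0$ and $n\in\mathbb{N}^*=\{1,2,\dots\}$, and let $[n]=\{1,\dots,n\}$ be the vertex set of the complete graph with a self-loop added at each vertex. Consider the transition matrix $P_{x,y}=\frac{1}{n(\epsilon+1)}$ for all $x,y\in[n]$ (simple random walk killed at each step with probability $\frac{\epsilon}{\epsilon+1}$). A based loop of length $k\in\mathbb{N}^*$ is an element $(x_1,\dots,x_k)$ of $[n]^k$; a loop is an equivalence class of based loops of the same length under cyclic shifts. Each based loop of length $k\ge 2$ has weight $\frac1k P_{x_1,x_2}\cdots P_{x_{k-1},x_k}P_{x_k,x_1}=\frac{1}{k(n(\epsilon+1))^k}$; this induces a measure $\mu$ on the set $\mathcal{DL}([n])$ of loops of length at least $2$. Let $\mathcal{DP}$ be a Poisson point process on $\mathbb{R}_+\times\mathcal{DL}([n])$ with intensity $\mathrm{Leb}\times\mu$, and let $\mathcal{DL}^{(n)}_t$ be the collection of loops (with multiplicity) of $\mathcal{DP}$ with time coordinate in $[0,t]$. $\mathcal{G}^{(n)}_t$ is the random graph on vertex set $[n]$ whose edges are those crossed by the loops of $\mathcal{DL}^{(n)}_t$ (the loop $(x_1,\dots,x_k)$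 crosses $\{x_1,x_2\},\dots,\{x_{k-1},x_k\},\{x_k,x_1\}$). $C^{(n)}_t(x)$ is the connected component of the vertex $x$ in $\mathcal{G}^{(n)}_t$ and $|C^{(n)}_t(x)|$ its number of vertices. For $p\in[0,1]$, $\mathcal{G}_{\mathbb{N}^*}(p)$ is the geometric distribution on $\mathbb{N}^*$: $k\mapsto(1-p)^{k-1}p$. For $\lambda>0$ and a probability distribution $\nu$, $\mathrm{CPois}(\lambda,\nu)$ is the law of $\sum_{i=1}^N X_i$ with $N$ Poisson of mean $\lambda$ and $(X_i)_i$ i.i.d. of law $\nu$ independent of $N$. $T^{(u)}_{\epsilon,t}\in\mathbb{N}^*\cup\{\infty\}$ is the total number of individuals (ancestors included) of a Galton-Watson process with $u$ ancestors and offspring distribution $\mathrm{CPois}\big(\frac{t}{\epsilon(\epsilon+1)},\mathcal{G}_{\mathbb{N}^*}(\frac{\epsilon}{\epsilon+1})\big)$. *)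

theory Defs
  imports "HOL-Probability.Probability" "HOL-Library.Landau_Symbols"
begin

section \<open>Poisson point processes\<close>

text \<open>
  A point process on the measurable space underlying \<open>I\<close> is a random integer-valued measure
  \<open>N \<omega>\<close>; \<open>emeasure (N \<omega>) B\<close> is the number of points in \<open>B\<close>, counted with multiplicity.
  The Poisson probabilities are written out because \<^const>\<open>poisson_pmf\<close> excludes the rate 0
  (here \<open>0 ^ 0 = 1\<close> gives the Dirac mass at 0).
\<close>

definition poisson_point_process ::
  "'w measure \<Rightarrow> 'a measure \<Rightarrow> ('w \<Rightarrow> 'a measure) \<Rightarrow> bool" where
  "poisson_point_process M I N \<longleftrightarrow>
     prob_space M \<and>
     (\<forall>\<omega>\<in>space M. sets (N \<omega>) = sets I \<and>
        (\<forall>B\<in>sets I. emeasure (N \<omega>) B \<in> insert \<infinity> (range of_nat))) \<and>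
     (\<forall>B\<in>sets I. (\<lambda>\<omega>. emeasure (N \<omega>) B) \<in> borel_measurable M) \<and>
     (\<forall>B\<in>sets I. emeasure I B < \<infinity> \<longrightarrow>
        (\<forall>j::nat. measure M {\<omega>\<in>space M. emeasure (N \<omega>) B = of_nat j} =
                  measure I B ^ j / fact j * exp (- measure I B))) \<and>
     (\<forall>B\<in>sets I. emeasure I B = \<infinity> \<longrightarrow> (AE \<omega> in M. emeasure (N \<omega>) B = \<infinity>)) \<and>
     (\<forall>(J::nat set) B. finite J \<longrightarrow> (\<forall>j\<in>J. B j \<in> sets I) \<longrightarrow> disjoint_family_on B J \<longrightarrow>
        prob_space.indep_vars M (\<lambda>_. borel) (\<lambda>j \<omega>. emeasure (N \<omega>) (B j)) J)"

section \<open>Loops on the complete graph\<close>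

definition trans_prob :: "real \<Rightarrow> nat \<Rightarrow> nat \<Rightarrow> nat \<Rightarrow> real" where
  "trans_prob \<epsilon> n x y = 1 / (real n * (\<epsilon> + 1))"

definition based_loops :: "nat \<Rightarrow> nat list set" where
  "based_loops n = {xs. xs \<noteq> [] \<and> set xs \<subseteq> {1..n}}"

definition loop_rel :: "nat \<Rightarrow> (nat list \<times> nat list) set" where
  "loop_rel n = {(xs, ys). xs \<in> based_loops n \<and> ys \<in> based_loops n \<and> (\<exists>m. ys = rotate m xs)}"

definition DL :: "nat \<Rightarrow> nat list set set" where
  "DL n = {l \<in> based_loops n // loop_rel n. \<forall>xs\<in>l. length xs \<ge> 2}"

definition based_weight :: "real \<Rightarrow> nat \<Rightarrow> nat list \<Rightarrow> real" where
  "based_weight \<epsilon> n xs =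
     1 / real (length xs) *
     (\<Prod>i<length xs. trans_prob \<epsilon> n (xs ! i) (xs ! (Suc i mod length xs)))"

text \<open>The mass of a loop is the total weight of the based loops it contains.\<close>

definition loop_measure :: "real \<Rightarrow> nat \<Rightarrow> nat list set measure" where
  "loop_measure \<epsilon> n = point_measure (DL n) (\<lambda>l. \<Sum>xs\<in>l. ennreal (based_weight \<epsilon> n xs))"

definition loop_intensity :: "real \<Rightarrow> nat \<Rightarrow> (real \<times> nat list set) measure" where
  "loop_intensity \<epsilon> n = restrict_space lborel {0..} \<Otimes>\<^sub>M loop_measure \<epsilon> n"

section \<open>The random graph\<close>

text \<open>
  The multiplicity of the loop \<open>l\<close> in the collection at time \<open>t\<close> is
  \<open>emeasure D ({0..t} \<times> {l})\<close>, where \<open>D\<close> is the realisation of the point process. Only the set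
  of loops with positive multiplicity matters for the graph.
\<close>

definition loops_upto :: "nat \<Rightarrow> (real \<times> nat list set) measure \<Rightarrow> real \<Rightarrow> nat list set set" where
  "loops_upto n D t = {l \<in> DL n. emeasure D ({0..t} \<times> {l}) > 0}"

text \<open>
  An edge is the set of its endpoints, a self-loop being a singleton. The edges crossed do not
  depend on the chosen representative of the loop.
\<close>

definition based_loop_edges :: "nat list \<Rightarrow> nat set set" where
  "based_loop_edges xs = {{xs ! i, xs ! (Suc i mod length xs)} | i. i < length xs}"

definition graph_edges :: "nat \<Rightarrow> (real \<times> nat list set) measure \<Rightarrow> real \<Rightarrow> nat set set" where
  "graph_edges n D t = (\<Union>l\<in>loops_upto n D t. \<Union>xs\<in>l. based_loop_edges xs)"

definition component :: "nat \<Rightarrow> (real \<times> nat list set) measure \<Rightarrow> real \<Rightarrow> nat \<Rightarrow> nat set" where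
  "component n D t x = {y \<in> {1..n}. (x, y) \<in> {(u, v). {u, v} \<in> graph_edges n D t}\<^sup>*}"

section \<open>Galton-Watson processes with compound Poisson offspring\<close>

text \<open>\<^const>\<open>geometric_pmf\<close> lives on \<open>{0, 1, \<dots>}\<close>; the shift gives \<open>k \<mapsto> (1 - p) ^ (k - 1) * p\<close>
  on \<open>{1, 2, \<dots>}\<close>.\<close>

definition geometric_pos_pmf :: "real \<Rightarrow> nat pmf" where
  "geometric_pos_pmf p = map_pmf Suc (geometric_pmf p)"

definition cpois_pmf :: "real \<Rightarrow> nat pmf \<Rightarrow> nat pmf" where
  "cpois_pmf r \<nu> = bind_pmf (poisson_pmf r) (\<lambda>N. map_pmf sum_list (replicate_pmf N \<nu>))"

text \<open>
  The coordinate \<open>\<xi> (g, i)\<close> is the number of children of the \<open>i\<close>-th individual of generation \<open>g\<close>.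
\<close>

definition gw_space :: "nat pmf \<Rightarrow> (nat \<times> nat \<Rightarrow> nat) measure" where
  "gw_space \<nu> = (\<Pi>\<^sub>M gi\<in>UNIV. measure_pmf \<nu>)"

primrec gw_generation :: "nat \<Rightarrow> (nat \<times> nat \<Rightarrow> nat) \<Rightarrow> nat \<Rightarrow> nat" where
  "gw_generation u \<xi> 0 = u"
| "gw_generation u \<xi> (Suc g) = (\<Sum>i<gw_generation u \<xi> g. \<xi> (g, i))"

definition gw_total :: "nat \<Rightarrow> (nat \<times> nat \<Rightarrow> nat) \<Rightarrow> enat" where
  "gw_total u \<xi> = (\<Sum>g. enat (gw_generation u \<xi> g))"

definition offspring_pmf :: "real \<Rightarrow> real \<Rightarrow> nat pmf" where
  "offspring_pmf \<epsilon> t = cpois_pmf (t / (\<epsilon> * (\<epsilon> + 1))) (geometric_pos_pmf (\<epsilon> / (\<epsilon> + 1)))"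

end

theory Submission
  imports Defs "HOL-Combinatorics.Multiset_Permutations"
begin

text \<open>
  A loop joins exactly the vertices that it visits, so the components of the random graph are those
  of the random hypergraph whose hyperedges are the supports of the loops present. By the Poisson
  property these hyperedges are independent: \<open>S\<close> is present with probability
  \<open>1 - exp (- \<theta> S)\<close>, where \<open>\<theta> S\<close> is \<open>n * t\<close> times the \<open>\<mu>\<close>-mass of the loops of support \<open>S\<close>. There
  are only finitely many supports, and after this reduction (\<open>prob_component_le\<close>) no infinite family
  of loops is left.

  The component of a vertex is explored one vertex at a time. From a set \<open>A\<close> of discovered vertices
  inside the set \<open>V'\<close> of vertices not yet explored, pick \<open>v \<in> A\<close> and reveal the hyperedges of \<open>V'\<close>
  through \<open>v\<close>. The hyperedges avoiding \<open>v\<close> are independent of them, so what remains is an exploration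
  of the same kind in \<open>V' - {v}\<close>. If the number of newly discovered vertices had exactly the offspring
  law \<open>\<nu>\<close>, this would be the exploration of a Galton-Watson tree, one individual at a time.

  One step is compared with \<open>\<nu>\<close> by a lower bound only. Put \<open>p = 1 / (n * (\<epsilon> + 1))\<close> and let
  \<open>\<Lambda> = t / (\<epsilon> * (\<epsilon> + 1))\<close> be the Poisson parameter of \<open>\<nu>\<close>. The total intensity of the hyperedges
  through \<open>v\<close> is at most \<open>\<Lambda>\<close>, while the loops which visit \<open>v\<close> once and then each point of \<open>B\<close>
  once already give \<open>\<theta> (insert v B) \<ge> n * t * |B|! * p ^ (|B| + 1)\<close>. Hence, for a set \<open>W\<close> of \<open>j\<close>
  available vertices, the probability that \<open>W\<close> is exactly the set of new vertices is at least
  \<open>exp (- \<Lambda>)\<close> times the sum over all partitions of \<open>W\<close> of the products of the \<open>\<theta> (insert v B)\<close>.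
  Splitting off the block of a given point shows that this partition sum obeys the recursion which
  also characterises the compound Poisson masses (Panjer's recursion), so the probability is at least
  \<open>j! * \<nu>(j) / n ^ j\<close>. With \<open>M\<close> available vertices, summing over \<open>W\<close> gives \<open>j\<close> new vertices with
  probability at least \<open>\<nu>(j) * M * (M - 1) * \<dots> * (M - j + 1) / n ^ j\<close>, which is at least
  \<open>\<nu>(j) * (1 - j * (n - M + j) / n)\<close>. Both laws have total mass one, so this one-sided estimate bounds
  their distance (\<open>expectation_diff_le_of_pmf_ge\<close>): multiple visits, overlapping loops and
  already discovered vertices can only account for the mass that is missing.

  As \<open>\<nu>\<close> has a finite second moment and \<open>n - M \<le> K\<close> while at most \<open>K\<close> vertices are discovered, one
  step costs \<open>O(K / n)\<close>. Deciding whether the component has at most \<open>K\<close> vertices takes at most \<open>K\<close>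
  steps, whence \<open>O(K\<^sup>2 / n)\<close> (\<open>prob_reach_close\<close>). Finally, the total progeny of the Galton-Watson process,
  defined generation by generation, satisfies the recursion of the exploration one individual at a
  time (\<open>prob_gw_total\<close>).
\<close>

section \<open>Random subsets with independent elements\<close>

text \<open>
  Each element \<open>e\<close> of \<open>L\<close> is kept independently with probability \<open>1 - exp (- \<theta> e)\<close>, that is, when a
  Poisson variable of mean \<open>\<theta> e\<close> is positive.
\<close>

definition random_subset :: "('e \<Rightarrow> real) \<Rightarrow> 'e set \<Rightarrow> 'e set pmf" where
  "random_subset \<theta> L =
     map_pmf Collect (Pi_pmf L False (\<lambda>e. bernoulli_pmf (1 - exp (- \<theta> e))))"

lemma set_random_subset:
  assumes "finite L"
  shows "set_pmf (random_subset \<theta> L) \<subseteq> Pow L"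
  using set_Pi_pmf_subset[OF assms, of False] unfolding random_subset_def by fastforce

lemma pmf_random_subset:
  assumes "finite L" "Q \<subseteq> L" "\<And>e. e \<in> L \<Longrightarrow> 0 \<le> \<theta> e"
  shows "pmf (random_subset \<theta> L) Q = (\<Prod>e\<in>Q. 1 - exp (- \<theta> e)) * (\<Prod>e\<in>L-Q. exp (- \<theta> e))"
proof -
  have "pmf (random_subset \<theta> L) (Collect (\<lambda>e. e \<in> Q)) =
      pmf (Pi_pmf L False (\<lambda>e. bernoulli_pmf (1 - exp (- \<theta> e)))) (\<lambda>e. e \<in> Q)"
    unfolding random_subset_def by (rule pmf_map_inj') (auto intro: injI)
  also have "\<dots> = (\<Prod>e\<in>L. pmf (bernoulli_pmf (1 - exp (- \<theta> e))) (e \<in> Q))"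
    using assms by (intro pmf_Pi') auto
  also have "\<dots> = (\<Prod>e\<in>L. if e \<in> Q then 1 - exp (- \<theta> e) else exp (- \<theta> e))"
    using assms(3) by (intro prod.cong) (auto simp: pmf_bernoulli_True pmf_bernoulli_False)
  also have "\<dots> = (\<Prod>e\<in>Q. 1 - exp (- \<theta> e)) * (\<Prod>e\<in>L-Q. exp (- \<theta> e))"
    using assms by (subst prod.If_cases) (auto simp: Int_absorb1 Diff_eq)
  finally show ?thesis by simp
qed

lemma random_subset_Un:
  assumes "finite A" "finite B" "A \<inter> B = {}"
  shows "random_subset \<theta> (A \<union> B) =
    bind_pmf (random_subset \<theta> B) (\<lambda>Q. map_pmf (\<lambda>P. P \<union> Q) (random_subset \<theta> A))"
proof -
  let ?b = "\<lambda>e. bernoulli_pmf (1 - exp (- \<theta> e))"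
  have "random_subset \<theta> (A \<union> B) =
      map_pmf (\<lambda>(f, g). Collect (\<lambda>x. if x \<in> A then f x else g x))
        (pair_pmf (Pi_pmf A False ?b) (Pi_pmf B False ?b))"
    unfolding random_subset_def Pi_pmf_union[OF assms]
    by (simp add: pmf.map_comp o_def case_prod_unfold)
  also have "\<dots> = map_pmf (\<lambda>(f, g). Collect f \<union> Collect g)
        (pair_pmf (Pi_pmf A False ?b) (Pi_pmf B False ?b))"
  proof (intro map_pmf_cong refl, clarify)
    fix f g assume "(f, g) \<in> set_pmf (pair_pmf (Pi_pmf A False ?b) (Pi_pmf B False ?b))"
    then have "\<forall>x. x \<notin> A \<longrightarrow> \<not> f x" "\<forall>x. x \<notin> B \<longrightarrow> \<not> g x"
      using set_Pi_pmf_subset[OF assms(1), of False ?b] set_Pi_pmf_subset[OF assms(2), of False ?b]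
      by auto
    then show "Collect (\<lambda>x. if x \<in> A then f x else g x) = Collect f \<union> Collect g"
      using assms(3) by auto
  qed
  also have "\<dots> = map_pmf (\<lambda>(P, Q). P \<union> Q) (pair_pmf (random_subset \<theta> A) (random_subset \<theta> B))"
    unfolding random_subset_def map_prod_def[symmetric] map_pair[symmetric]
    by (simp add: pmf.map_comp o_def case_prod_unfold)
  also have "\<dots> = bind_pmf (random_subset \<theta> B) (\<lambda>Q. map_pmf (\<lambda>P. P \<union> Q) (random_subset \<theta> A))"
    unfolding pair_pmf_def map_bind_pmf map_pmf_def[of _ "random_subset \<theta> A"]
    by (subst bind_commute_pmf) (simp add: bind_return_pmf)
  finally show ?thesis .
qed

text \<open>
  The bound \<open>\<theta> * exp (- \<theta>) \<le> 1 - exp (- \<theta>)\<close> turns each factor of a present element into an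
  intensity, at the price of the void probability of the whole index set.
\<close>

lemma pmf_random_subset_ge:
  assumes "finite L" "Q \<subseteq> L" "\<And>e. e \<in> L \<Longrightarrow> 0 \<le> \<theta> e"
  shows "exp (- (\<Sum>e\<in>L. \<theta> e)) * (\<Prod>e\<in>Q. \<theta> e) \<le> pmf (random_subset \<theta> L) Q"
proof -
  have fin: "finite Q" using assms finite_subset by blast
  have "exp (- (\<Sum>e\<in>L. \<theta> e)) * (\<Prod>e\<in>Q. \<theta> e) =
      (\<Prod>e\<in>Q. \<theta> e * exp (- \<theta> e)) * (\<Prod>e\<in>L-Q. exp (- \<theta> e))"
  proof -
    have "exp (- (\<Sum>e\<in>L. \<theta> e)) = (\<Prod>e\<in>L. exp (- \<theta> e))"
      using assms(1) by (simp add: exp_sum flip: sum_negf)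
    also have "\<dots> = (\<Prod>e\<in>L-Q. exp (- \<theta> e)) * (\<Prod>e\<in>Q. exp (- \<theta> e))"
      using assms by (intro prod.subset_diff) auto
    finally show ?thesis by (simp add: prod.distrib)
  qed
  also have "\<dots> \<le> (\<Prod>e\<in>Q. 1 - exp (- \<theta> e)) * (\<Prod>e\<in>L-Q. exp (- \<theta> e))"
  proof (intro mult_right_mono prod_mono conjI)
    fix e assume e: "e \<in> Q"
    show "0 \<le> \<theta> e * exp (- \<theta> e)" using e assms by auto
    have "(1 + \<theta> e) * exp (- \<theta> e) \<le> exp (\<theta> e) * exp (- \<theta> e)"
      by (intro mult_right_mono) auto
    then show "\<theta> e * exp (- \<theta> e) \<le> 1 - exp (- \<theta> e)"
      by (simp add: algebra_simps flip: exp_add)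
  qed (auto intro: prod_nonneg)
  also have "\<dots> = pmf (random_subset \<theta> L) Q"
    using assms by (rule pmf_random_subset[symmetric])
  finally show ?thesis .
qed

section \<open>Reachability in hypergraphs\<close>

definition hyper_adj :: "'a set set \<Rightarrow> ('a \<times> 'a) set" where
  "hyper_adj H = {(u, v). \<exists>e\<in>H. u \<in> e \<and> v \<in> e}"

definition reach :: "'a set set \<Rightarrow> 'a set \<Rightarrow> 'a set" where
  "reach H A = (hyper_adj H)\<^sup>* `` A"

lemma reach_subset_closed:
  assumes "A \<subseteq> R" "\<And>e. e \<in> H \<Longrightarrow> e \<inter> R \<noteq> {} \<Longrightarrow> e \<subseteq> R"
  shows "reach H A \<subseteq> R"
proof
  fix y assume "y \<in> reach H A"
  then obtain a where "a \<in> A" "(a, y) \<in> (hyper_adj H)\<^sup>*" by (auto simp: reach_def)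
  from this(2) show "y \<in> R"
  proof induction
    case base
    show ?case using \<open>a \<in> A\<close> assms(1) by blast
  next
    case (step y z)
    then obtain e where "e \<in> H" "y \<in> e" "z \<in> e" by (auto simp: hyper_adj_def)
    with step assms(2)[of e] show ?case by blast
  qed
qed

lemma subset_reach: "A \<subseteq> reach H A"
  by (auto simp: reach_def)

lemma reach_edge:
  assumes "e \<in> H" "e \<inter> reach H A \<noteq> {}"
  shows "e \<subseteq> reach H A"
proof
  fix y assume y: "y \<in> e"
  from assms obtain z a where "z \<in> e" "a \<in> A" and az: "(a, z) \<in> (hyper_adj H)\<^sup>*"
    unfolding reach_def by blast
  have "(z, y) \<in> hyper_adj H"
    using assms(1) y \<open>z \<in> e\<close> by (auto simp: hyper_adj_def)
  with az have "(a, y) \<in> (hyper_adj H)\<^sup>*"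
    by (rule rtrancl_into_rtrancl)
  then show "y \<in> reach H A" using \<open>a \<in> A\<close> unfolding reach_def by blast
qed

lemma reach_empty [simp]: "reach H {} = {}"
  by (simp add: reach_def)

lemma reach_bounded: "\<Union>H \<subseteq> V \<Longrightarrow> A \<subseteq> V \<Longrightarrow> reach H A \<subseteq> V"
  by (rule reach_subset_closed) auto

text \<open>
  The exploration step: once the hyperedges through \<open>v\<close> have been used, \<open>v\<close> itself is finished and
  only hyperedges avoiding \<open>v\<close> remain to be followed.
\<close>

lemma reach_explore:
  assumes "v \<in> A" and Q: "\<And>e. e \<in> Q \<Longrightarrow> v \<in> e" and P: "\<And>e. e \<in> P \<Longrightarrow> v \<notin> e"
  shows "reach (P \<union> Q) A = insert v (reach P ((A \<union> \<Union>Q) - {v}))"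
proof
  define l where "l = reach (P \<union> Q) A"
  define A' where "A' = (A \<union> \<Union>Q) - {v}"
  define r where "r = reach P A'"
  have A'r: "A' \<subseteq> r" unfolding r_def by (rule subset_reach)
  have Al: "A \<subseteq> l" unfolding l_def by (rule subset_reach)
  have Pr: "e \<subseteq> r" if "e \<in> P" "e \<inter> r \<noteq> {}" for e
    using that unfolding r_def by (rule reach_edge)
  have PQl: "e \<subseteq> l" if "e \<in> P \<union> Q" "e \<inter> l \<noteq> {}" for e
    using that unfolding l_def by (rule reach_edge)
  have "l \<subseteq> insert v r"
    unfolding l_def
  proof (rule reach_subset_closed)
    show "A \<subseteq> insert v r" using A'r by (auto simp: A'_def)
    fix e assume e: "e \<in> P \<union> Q" "e \<inter> insert v r \<noteq> {}"
    show "e \<subseteq> insert v r"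
    proof (cases "e \<in> Q")
      case True
      then show ?thesis using A'r by (auto simp: A'_def)
    next
      case False
      then show ?thesis using e P[of e] Pr[of e] by blast
    qed
  qed
  then show "reach (P \<union> Q) A \<subseteq> insert v (reach P ((A \<union> \<Union>Q) - {v}))"
    by (simp add: l_def r_def A'_def)
  have v: "v \<in> l" using \<open>v \<in> A\<close> Al by blast
  have Ql: "e \<subseteq> l" if "e \<in> Q" for e
    using PQl[of e] that Q[of e] v by blast
  have "r \<subseteq> l"
    unfolding r_def
  proof (rule reach_subset_closed)
    show "A' \<subseteq> l" using Ql Al unfolding A'_def by blast
    show "e \<subseteq> l" if "e \<in> P" "e \<inter> l \<noteq> {}" for e
      using that by (intro PQl) auto
  qed
  with v show "insert v (reach P ((A \<union> \<Union>Q) - {v})) \<subseteq> reach (P \<union> Q) A"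
    by (simp add: l_def r_def A'_def)
qed

section \<open>Expectations under comparable laws\<close>

lemma prob_bind_pmf:
  "measure_pmf.prob (bind_pmf M f) S = measure_pmf.expectation M (\<lambda>x. measure_pmf.prob (f x) S)"
  unfolding measure_pmf_bind
  by (rule measure_pmf.measure_bind[where N="count_space UNIV"])
     (auto simp: space_subprob_algebra prob_space_imp_subprob_space measure_pmf.prob_space_axioms)

lemma integrable_bounded_pmf:
  fixes f :: "'a \<Rightarrow> real"
  assumes "\<And>x. \<bar>f x\<bar> \<le> B"
  shows "integrable (measure_pmf M) f"
  by (rule measure_pmf.integrable_const_bound[where B=B]) (use assms in auto)

lemma expectation_eq_integral_count_space:
  fixes f :: "'a \<Rightarrow> real"
  shows "measure_pmf.expectation p f = (\<integral>x. pmf p x * f x \<partial>count_space UNIV)"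
  unfolding measure_pmf_eq_density by (subst integral_density) auto

lemma integrable_pmf_iff_count_space:
  fixes f :: "'a \<Rightarrow> real"
  shows "integrable (measure_pmf p) f \<longleftrightarrow> integrable (count_space UNIV) (\<lambda>x. pmf p x * f x)"
  unfolding measure_pmf_eq_density by (subst integrable_density) auto

text \<open>
  Lower bounds on the masses give lower bounds on expectations; applied to \<open>\<phi>\<close> and to \<open>1 - \<phi>\<close>, they
  give the two-sided estimate below, because both laws have total mass one.
\<close>

lemma expectation_le_of_pmf_ge:
  fixes p \<nu> :: "'a pmf" and c \<phi> :: "'a \<Rightarrow> real"
  assumes dom: "\<And>j. pmf \<nu> j * (1 - c j) \<le> pmf p j"
    and c: "integrable (measure_pmf \<nu>) c" "\<And>j. 0 \<le> c j" and \<phi>: "\<And>j. 0 \<le> \<phi> j" "\<And>j. \<phi> j \<le> 1"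
  shows "measure_pmf.expectation \<nu> \<phi> \<le> measure_pmf.expectation p \<phi> + measure_pmf.expectation \<nu> c"
proof -
  have int: "integrable (measure_pmf q) \<phi>" for q
    using \<phi> by (intro integrable_bounded_pmf[where B=1]) (simp add: abs_of_nonneg)
  have "measure_pmf.expectation \<nu> \<phi> \<le> (\<integral>x. pmf p x * \<phi> x + pmf \<nu> x * c x \<partial>count_space UNIV)"
    unfolding expectation_eq_integral_count_space
  proof (intro integral_mono Bochner_Integration.integrable_add)
    fix x
    have "pmf \<nu> x * \<phi> x = pmf \<nu> x * (1 - c x) * \<phi> x + pmf \<nu> x * c x * \<phi> x"
      by (simp add: algebra_simps)
    also have "\<dots> \<le> pmf p x * \<phi> x + pmf \<nu> x * c x * 1"
      using dom[of x] c(2)[of x] \<phi>[of x] by (intro add_mono mult_right_mono mult_left_mono) auto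
    finally show "pmf \<nu> x * \<phi> x \<le> pmf p x * \<phi> x + pmf \<nu> x * c x" by simp
  qed (use int c in \<open>simp_all flip: integrable_pmf_iff_count_space\<close>)
  also have "\<dots> = measure_pmf.expectation p \<phi> + measure_pmf.expectation \<nu> c"
    unfolding expectation_eq_integral_count_space
    by (rule Bochner_Integration.integral_add) (use int c in \<open>simp_all flip: integrable_pmf_iff_count_space\<close>)
  finally show ?thesis .
qed

lemma expectation_diff_le_of_pmf_ge:
  fixes p \<nu> :: "'a pmf" and c \<phi> :: "'a \<Rightarrow> real"
  assumes dom: "\<And>j. pmf \<nu> j * (1 - c j) \<le> pmf p j"
    and c: "integrable (measure_pmf \<nu>) c" "\<And>j. 0 \<le> c j" and \<phi>: "\<And>j. 0 \<le> \<phi> j" "\<And>j. \<phi> j \<le> 1"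
  shows "\<bar>measure_pmf.expectation p \<phi> - measure_pmf.expectation \<nu> \<phi>\<bar> \<le> measure_pmf.expectation \<nu> c"
proof -
  have int: "integrable (measure_pmf q) \<phi>" for q
    using \<phi> by (intro integrable_bounded_pmf[where B=1]) (simp add: abs_of_nonneg)
  have "measure_pmf.expectation \<nu> (\<lambda>j. 1 - \<phi> j)
      \<le> measure_pmf.expectation p (\<lambda>j. 1 - \<phi> j) + measure_pmf.expectation \<nu> c"
    using \<phi> by (intro expectation_le_of_pmf_ge dom c) auto
  moreover have "measure_pmf.expectation q (\<lambda>j. 1 - \<phi> j) = 1 - measure_pmf.expectation q \<phi>" for q
    using int by simp
  ultimately show ?thesis
    using expectation_le_of_pmf_ge[of \<nu> c p \<phi>, OF dom c \<phi>] by (simp add: abs_le_iff)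
qed

section \<open>Sums over set partitions\<close>

lemma sum_Pow_card:
  fixes F :: "nat \<Rightarrow> real"
  assumes "finite X"
  shows "(\<Sum>C\<in>Pow X. F (card C)) = (\<Sum>i\<le>card X. real (card X choose i) * F i)"
proof -
  have "(\<Sum>C\<in>Pow X. F (card C)) = (\<Sum>i\<le>card X. \<Sum>C\<in>{C\<in>Pow X. card C = i}. F (card C))"
    using assms by (intro sum.group[symmetric]) (auto intro: card_mono)
  also have "\<dots> = (\<Sum>i\<le>card X. real (card X choose i) * F i)"
    using n_subsets[OF assms] by (intro sum.cong) (auto simp: Pow_def)
  finally show ?thesis .
qed

text \<open>
  The right-hand side splits according to the block \<open>insert x C\<close> of a fixed point \<open>x\<close> of \<open>W\<close>: the
  remaining blocks partition the complement. Counting the sets \<open>C\<close> of size \<open>i\<close> by a binomial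
  coefficient turns the induction hypothesis into the recursion for \<open>\<rho>\<close>, the factorials absorbing the
  binomial coefficients. If \<open>w B = fact (card B) * l (card B)\<close>, equality holds, and the identity is the
  exponential formula for \<open>\<rho>\<close>, the coefficients of the exponential of the generating function of \<open>l\<close>.
\<close>

lemma sum_partitions_ge:
  fixes w :: "'a set \<Rightarrow> real" and \<rho> l :: "nat \<Rightarrow> real"
  assumes "finite W"
    and w: "\<And>B. B \<subseteq> W \<Longrightarrow> B \<noteq> {} \<Longrightarrow> fact (card B) * l (card B) \<le> w B"
    and l: "\<And>k. 0 \<le> l k" and \<rho>: "\<And>k. 0 \<le> \<rho> k" and \<rho>0: "\<rho> 0 = 1"
    and panjer: "\<And>j. real (Suc j) * \<rho> (Suc j) = (\<Sum>i\<le>j. real (Suc i) * l (Suc i) * \<rho> (j - i))"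
  shows "fact (card W) * \<rho> (card W) \<le> (\<Sum>P | partition_on W P. \<Prod>B\<in>P. w B)"
  using assms(1) w
proof (induction W rule: finite_psubset_induct)
  case (psubset W)
  show ?case
  proof (cases "W = {}")
    case True
    have "{P. partition_on W P} = {{}}" using True by (auto simp: partition_on_empty)
    then show ?thesis using True \<rho>0 by simp
  next
    case False
    then obtain x where x: "x \<in> W" by auto
    define X where "X = W - {x}"
    have X: "W = insert x X" "x \<notin> X" "finite X" using x psubset by (auto simp: X_def)
    define S where "S = (SIGMA C:Pow X. {P. partition_on (X - C) P})"
    have w0: "0 \<le> w B" if "B \<subseteq> W" "B \<noteq> {}" for B
      using psubset(3)[OF that] l[of "card B"] order_trans[of 0 "fact (card B) * l (card B)" "w B"] by auto
    have notx: "B \<notin> P" if "partition_on (X - C) P" "x \<in> B" for B C P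
      using that X by (auto simp: partition_on_def)
    have finP: "finite P" if "partition_on (X - C) P" for C P
      using that X by (intro finite_elements[of "X - C"]) auto
    \<comment> \<open>\<open>insert x C\<close> can be recovered as the only block containing \<open>x\<close>.\<close>
    have inj: "inj_on (\<lambda>(C, P). insert (insert x C) P) S"
    proof (rule inj_onI, clarify)
      fix C P C' P'
      assume in1: "(C, P) \<in> S" and in2: "(C', P') \<in> S"
        and eq: "insert (insert x C) P = insert (insert x C') P'"
      have a: "insert x C \<notin> P'" "insert x C' \<notin> P" "insert x C \<notin> P" "insert x C' \<notin> P'"
        using in1 in2 notx by (auto simp: S_def)
      with eq have "insert x C = insert x C'" by auto
      moreover have "x \<notin> C" "x \<notin> C'" using in1 in2 X by (auto simp: S_def)
      ultimately have "C = C'" by (metis insert_ident)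
      with eq a show "C = C' \<and> P = P'" by (metis insert_ident)
    qed
    have img: "(\<lambda>(C, P). insert (insert x C) P) ` S \<subseteq> {P. partition_on W P}"
    proof (clarify)
      fix C P assume "(C, P) \<in> S"
      then have CP: "C \<subseteq> X" "partition_on (X - C) P" by (auto simp: S_def)
      have "W - insert x C = X - C" using X by auto
      moreover have "disjnt (insert x C) (\<Union>P)"
        using CP X by (auto simp: partition_on_def disjnt_def)
      ultimately show "partition_on W (insert (insert x C) P)"
        using CP X by (subst partition_on_insert) auto
    qed
    have fact_id: "real (card X choose i) * (fact (Suc i) * fact (card X - i)) = fact (card X) * real (Suc i)"
      if "i \<le> card X" for i
    proof -
      have "real (fact i * fact (card X - i) * (card X choose i)) = real (fact (card X))"
        using binomial_fact_lemma[OF that] by simp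
      then show ?thesis by (simp add: algebra_simps)
    qed
    have card: "card W = Suc (card X)" using X by simp
    have "fact (card W) * \<rho> (card W) = fact (card X) * (real (Suc (card X)) * \<rho> (Suc (card X)))"
      by (simp add: card)
    also have "\<dots> = (\<Sum>i\<le>card X. fact (card X) * real (Suc i) * (l (Suc i) * \<rho> (card X - i)))"
      unfolding panjer by (simp add: sum_distrib_left mult_ac)
    also have "\<dots> = (\<Sum>i\<le>card X. real (card X choose i) *
        ((fact (Suc i) * l (Suc i)) * (fact (card X - i) * \<rho> (card X - i))))"
      by (intro sum.cong refl, subst fact_id[symmetric]) (auto simp: mult_ac)
    also have "\<dots> = (\<Sum>C\<in>Pow X. (fact (Suc (card C)) * l (Suc (card C))) *
        (fact (card X - card C) * \<rho> (card X - card C)))"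
      using X by (subst sum_Pow_card[symmetric]) auto
    also have "\<dots> \<le> (\<Sum>C\<in>Pow X. w (insert x C) * (\<Sum>P | partition_on (X - C) P. \<Prod>B\<in>P. w B))"
    proof (intro sum_mono mult_mono)
      fix C assume C: "C \<in> Pow X"
      then have fC: "finite C" "x \<notin> C" using X finite_subset by auto
      have "fact (card (insert x C)) * l (card (insert x C)) \<le> w (insert x C)"
        using C X by (intro psubset(3)) auto
      then show "fact (Suc (card C)) * l (Suc (card C)) \<le> w (insert x C)"
        using fC by simp
      have "fact (card (X - C)) * \<rho> (card (X - C)) \<le> (\<Sum>P | partition_on (X - C) P. \<Prod>B\<in>P. w B)"
        using X by (intro psubset(2) psubset(3)) auto
      then show "fact (card X - card C) * \<rho> (card X - card C) \<le> (\<Sum>P | partition_on (X - C) P. \<Prod>B\<in>P. w B)"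
        using C X fC by (simp add: card_Diff_subset)
      show "0 \<le> w (insert x C)" using C X by (intro w0) auto
    qed (use l \<rho> in auto)
    also have "\<dots> = (\<Sum>(C, P)\<in>S. w (insert x C) * (\<Prod>B\<in>P. w B))"
      unfolding S_def sum_distrib_left
      using X by (subst sum.Sigma) (auto intro: finitely_many_partition_on)
    also have "\<dots> = (\<Sum>(C, P)\<in>S. \<Prod>B\<in>insert (insert x C) P. w B)"
      using notx finP by (intro sum.cong) (auto simp: S_def)
    also have "\<dots> = (\<Sum>P\<in>(\<lambda>(C, P). insert (insert x C) P) ` S. \<Prod>B\<in>P. w B)"
      using inj by (simp add: sum.reindex case_prod_unfold)
    also have "\<dots> \<le> (\<Sum>P | partition_on W P. \<Prod>B\<in>P. w B)"
      using img psubset(1)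
    proof (intro sum_mono2 finitely_many_partition_on prod_nonneg)
      fix P B assume "P \<in> {P. partition_on W P} - (\<lambda>(C, P). insert (insert x C) P) ` S" "B \<in> P"
      then show "0 \<le> w B" by (intro w0) (auto simp: partition_on_def)
    qed auto
    finally show ?thesis .
  qed
qed

section \<open>Exploration of a random hypergraph\<close>

text \<open>
  The right-hand side is \<open>M * (M - 1) * \<dots> * (M - j + 1) / n ^ j\<close>, and each of its \<open>j\<close> factors
  \<open>(M - i) / n\<close> differs from 1 by at most \<open>(n - M + j) / n\<close>.
\<close>

lemma falling_factorial_ge:
  assumes "M \<le> n" "0 < n"
  shows "1 - real j * (real n - real M + real j) / real n \<le> fact j * real (M choose j) / real n ^ j"
    (is "_ \<le> ?y j")
proof -
  have y: "?y j = (\<Prod>i<j. (real M - real i) / real n)" for j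
    by (simp add: prod_dividef binomial_gbinomial gbinomial_prod_rev atLeast0LessThan)
  have y1: "?y j \<le> 1" for j
  proof (induction j)
    case (Suc j)
    show ?case
    proof (cases "j \<le> M")
      case True
      have "?y (Suc j) = ?y j * ((real M - real j) / real n)" unfolding y by simp
      also have "\<dots> \<le> 1 * 1"
        using Suc True assms by (intro mult_mono) auto
      finally show ?thesis by simp
    qed (simp add: binomial_eq_0)
  qed simp
  show ?thesis
  proof (induction j)
    case (Suc j)
    define d where "d = (real n - real M + real j) / real n"
    have d: "0 \<le> d" using assms by (simp add: d_def)
    have e: "(real M - real j) / real n = 1 - d" using assms by (simp add: d_def field_simps)
    have "?y (Suc j) = ?y j * ((real M - real j) / real n)" unfolding y by simp
    also have "\<dots> = ?y j - ?y j * d" unfolding e by (simp only: right_diff_distrib mult_1_right)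
    also have "\<dots> \<ge> ?y j - 1 * d" using y1[of j] d by (intro diff_left_mono mult_right_mono) auto
    finally have 1: "?y j - d \<le> ?y (Suc j)" by simp
    have "real j * (real n - real M + real j) + (real n - real M + real j)
      \<le> real (Suc j) * (real n - real M + real (Suc j))"
      using assms by (simp add: algebra_simps)
    then have "real j * (real n - real M + real j) / real n + d
      \<le> real (Suc j) * (real n - real M + real (Suc j)) / real n"
      unfolding d_def add_divide_distrib[symmetric] by (intro divide_right_mono) auto
    with 1 Suc show ?case by linarith
  qed simp
qed

text \<open>
  A hypergraph whose exploration is compared with the offspring law \<open>\<nu>\<close>. The parameters \<open>\<Lambda>\<close> and
  \<open>l k\<close> are the total jump rate of \<open>\<nu>\<close> and its rate of jumps of size \<open>k\<close>; \<open>\<nu>_0\<close> and \<open>\<nu>_Suc\<close> are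
  Panjer's recursion, which determines \<open>\<nu>\<close>. The intensity \<open>\<theta> (insert v B)\<close> is bounded from below by
  the rate \<open>l k\<close>, where \<open>k = card B\<close>, shared equally among the ordered \<open>k\<close>-tuples of vertices, of which
  \<open>fact k\<close> enumerate \<open>B\<close>. The bound \<open>\<Lambda>\<close> on the total intensity
  at a vertex limits what the hyperedges can exceed these lower bounds by.
\<close>

locale hypergraph_near_branching =
  fixes V :: "'a set" and \<theta> :: "'a set \<Rightarrow> real" and \<nu> :: "nat pmf" and \<Lambda> :: real and l :: "nat \<Rightarrow> real"
  assumes finite_V: "finite V"
    and \<theta>_nonneg: "\<And>e. e \<subseteq> V \<Longrightarrow> 0 \<le> \<theta> e"
    and \<theta>_total: "\<And>v. v \<in> V \<Longrightarrow> (\<Sum>e\<in>{e \<in> Pow V. v \<in> e}. \<theta> e) \<le> \<Lambda>"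
    and \<theta>_lower: "\<And>v B. v \<in> V \<Longrightarrow> B \<subseteq> V \<Longrightarrow> v \<notin> B \<Longrightarrow> B \<noteq> {} \<Longrightarrow>
       fact (card B) * (l (card B) / real (card V) ^ card B) \<le> \<theta> (insert v B)"
    and l_nonneg: "\<And>k. 0 \<le> l k"
    and \<nu>_0: "pmf \<nu> 0 = exp (- \<Lambda>)"
    and \<nu>_Suc: "\<And>j. real (Suc j) * pmf \<nu> (Suc j) = (\<Sum>i\<le>j. real (Suc i) * l (Suc i) * pmf \<nu> (j - i))"
    and \<nu>_square: "integrable (measure_pmf \<nu>) (\<lambda>j. real j ^ 2)"
begin

text \<open>
  If the hyperedges through \<open>v\<close> are exactly the \<open>insert v B\<close> for the blocks \<open>B\<close> of a partition of \<open>W\<close>,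
  then \<open>W\<close> is the set of vertices that they discover. These disjoint configurations alone
  carry the mass \<open>j! * \<nu>(j) / n ^ j\<close>, where \<open>j = card W\<close>.
\<close>

lemma discovered_set_ge:
  assumes v: "v \<in> A" and A: "A \<subseteq> V'" and V': "V' \<subseteq> V" and W: "W \<subseteq> V' - A"
  shows "fact (card W) * pmf \<nu> (card W) / real (card V) ^ card W \<le>
    (\<Sum>P | partition_on W P. pmf (random_subset \<theta> {e \<in> Pow V'. v \<in> e}) (insert v ` P))"
proof -
  let ?n = "real (card V)" and ?L = "{e \<in> Pow V'. v \<in> e}"
  have V: "v \<in> V" using v A V' by blast
  have fin: "finite V'" using V' finite_V by (rule finite_subset)
  have finW: "finite W" using W fin by (meson finite_Diff finite_subset)
  have n: "0 < card V" using V finite_V card_gt_0_iff[of V] by auto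
  \<comment> \<open>Rescaled so that \<open>\<rho> 0 = 1\<close> and each new vertex carries a factor \<open>1 / n\<close>.\<close>
  define \<rho> where "\<rho> j = exp \<Lambda> * pmf \<nu> j / ?n ^ j" for j
  have "fact (card W) * \<rho> (card W) \<le> (\<Sum>P | partition_on W P. \<Prod>B\<in>P. \<theta> (insert v B))"
  proof (rule sum_partitions_ge[where l="\<lambda>k. l k / ?n ^ k"])
    fix j
    have "real (Suc j) * \<rho> (Suc j) = exp \<Lambda> * (real (Suc j) * pmf \<nu> (Suc j)) / ?n ^ Suc j"
      by (simp add: \<rho>_def)
    also have "\<dots> = (\<Sum>i\<le>j. exp \<Lambda> * (real (Suc i) * l (Suc i) * pmf \<nu> (j - i)) / ?n ^ Suc j)"
      by (simp only: \<nu>_Suc sum_distrib_left sum_divide_distrib)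
    also have "\<dots> = (\<Sum>i\<le>j. real (Suc i) * (l (Suc i) / ?n ^ Suc i) * \<rho> (j - i))"
    proof (intro sum.cong refl)
      fix i assume "i \<in> {..j}"
      then have split: "?n ^ Suc j = ?n ^ Suc i * ?n ^ (j - i)" by (simp flip: power_add)
      show "exp \<Lambda> * (real (Suc i) * l (Suc i) * pmf \<nu> (j - i)) / ?n ^ Suc j
          = real (Suc i) * (l (Suc i) / ?n ^ Suc i) * \<rho> (j - i)"
        unfolding \<rho>_def split by (simp add: mult_ac)
    qed
    finally show "real (Suc j) * \<rho> (Suc j) = (\<Sum>i\<le>j. real (Suc i) * (l (Suc i) / ?n ^ Suc i) * \<rho> (j - i))" .
  next
    fix B assume "B \<subseteq> W" "B \<noteq> {}"
    then show "fact (card B) * (l (card B) / ?n ^ card B) \<le> \<theta> (insert v B)"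
      using assms V by (intro \<theta>_lower) auto
  qed (use finW l_nonneg in \<open>auto simp: \<rho>_def \<nu>_0 simp flip: exp_add\<close>)
  then have "exp (- \<Lambda>) * (fact (card W) * \<rho> (card W)) \<le>
      exp (- \<Lambda>) * (\<Sum>P | partition_on W P. \<Prod>B\<in>P. \<theta> (insert v B))"
    by (intro mult_left_mono) auto
  moreover have "exp (- \<Lambda>) * (fact (card W) * \<rho> (card W)) = fact (card W) * pmf \<nu> (card W) / ?n ^ card W"
    by (simp add: \<rho>_def exp_minus)
  ultimately have "fact (card W) * pmf \<nu> (card W) / ?n ^ card W \<le>
      (\<Sum>P | partition_on W P. exp (- \<Lambda>) * (\<Prod>B\<in>P. \<theta> (insert v B)))"
    by (simp add: sum_distrib_left)
  also have "\<dots> \<le> (\<Sum>P | partition_on W P. pmf (random_subset \<theta> ?L) (insert v ` P))"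
  proof (intro sum_mono)
    fix P assume "P \<in> {P. partition_on W P}"
    then have P: "partition_on W P" by simp
    have PW: "B \<subseteq> W" if "B \<in> P" for B using P that by (auto simp: partition_on_def)
    have vW: "v \<notin> W" using v W by auto
    have inj: "inj_on (insert v) P"
      using PW vW by (intro inj_onI) (metis insert_ident subsetD)
    have "(\<Sum>e\<in>?L. \<theta> e) \<le> (\<Sum>e\<in>{e \<in> Pow V. v \<in> e}. \<theta> e)"
      using V' finite_V \<theta>_nonneg by (intro sum_mono2) auto
    also have "\<dots> \<le> \<Lambda>" using V by (intro \<theta>_total)
    finally have "exp (- \<Lambda>) * (\<Prod>B\<in>P. \<theta> (insert v B)) \<le> exp (- (\<Sum>e\<in>?L. \<theta> e)) * (\<Prod>e\<in>insert v ` P. \<theta> e)"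
      using inj PW W V' V A v
      by (subst prod.reindex, force, intro mult_mono) (auto intro!: prod_nonneg \<theta>_nonneg)
    also have "\<dots> \<le> pmf (random_subset \<theta> ?L) (insert v ` P)"
    proof (rule pmf_random_subset_ge)
      show "finite ?L" using fin by auto
      show "insert v ` P \<subseteq> ?L" using PW W A v by blast
    qed (use V' in \<open>auto intro!: \<theta>_nonneg\<close>)
    finally show "exp (- \<Lambda>) * (\<Prod>B\<in>P. \<theta> (insert v B)) \<le> pmf (random_subset \<theta> ?L) (insert v ` P)" .
  qed
  finally show ?thesis .
qed

text \<open>
  There are \<open>card (V' - A) choose j\<close> possible sets of new vertices, and different pairs of such a set
  and a partition of it arise from different sets of hyperedges.
\<close>

lemma pmf_discovered_ge:
  assumes v: "v \<in> A" and A: "A \<subseteq> V'" and V': "V' \<subseteq> V"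
  shows "pmf \<nu> j * (1 - real j * (real (card V) - real (card (V' - A)) + real j) / real (card V)) \<le>
    pmf (map_pmf (\<lambda>Q. card (\<Union>Q - A)) (random_subset \<theta> {e \<in> Pow V'. v \<in> e})) j"
proof -
  let ?n = "real (card V)" and ?L = "{e \<in> Pow V'. v \<in> e}" and ?M = "card (V' - A)"
  have V: "v \<in> V" using v A V' by blast
  have fin: "finite V'" using V' finite_V by (rule finite_subset)
  have n: "0 < card V" using V finite_V card_gt_0_iff[of V] by auto
  define Ws where "Ws = {W. W \<subseteq> V' - A \<and> card W = j}"
  define Ps where "Ps = (SIGMA W:Ws. {P. partition_on W P})"
  have finW: "finite W" if "W \<in> Ws" for W using that fin by (auto simp: Ws_def intro: finite_subset[of _ V'])
  have "Ws \<subseteq> Pow V'" by (auto simp: Ws_def)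
  then have finWs: "finite Ws" using fin by (meson finite_Pow_iff finite_subset)
  have finPs: "finite Ps"
    unfolding Ps_def using finWs finW by (intro finite_SigmaI) (auto intro: finitely_many_partition_on)
  have inv: "(\<lambda>e. e - {v}) ` insert v ` P = P" if "(W, P) \<in> Ps" for W P
  proof -
    have "B - {v} = B" if "B \<in> P" for B
      using \<open>(W, P) \<in> Ps\<close> that v by (auto simp: Ps_def Ws_def partition_on_def)
    then show ?thesis by (force simp: image_image)
  qed
  have inj: "inj_on (\<lambda>(W, P). insert v ` P) Ps"
  proof (rule inj_onI, clarify)
    fix W P W' P' assume *: "(W, P) \<in> Ps" "(W', P') \<in> Ps" and eq: "insert v ` P = insert v ` P'"
    have "P = P'" using inv[OF *(1)] inv[OF *(2)] eq by metis
    moreover have "W = \<Union>P" "W' = \<Union>P'" using * by (auto simp: Ps_def partition_on_def)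
    ultimately show "W = W' \<and> P = P'" by simp
  qed
  have "1 - real j * (?n - real ?M + real j) / ?n \<le> fact j * real (?M choose j) / ?n ^ j"
  proof (rule falling_factorial_ge)
    show "?M \<le> card V" using V' finite_V by (intro card_mono) auto
  qed (use n in simp)
  then have "pmf \<nu> j * (1 - real j * (?n - real ?M + real j) / ?n)
      \<le> pmf \<nu> j * (fact j * real (?M choose j) / ?n ^ j)"
    by (intro mult_left_mono) auto
  also have "\<dots> = (\<Sum>W\<in>Ws. fact (card W) * pmf \<nu> (card W) / ?n ^ card W)"
  proof -
    have "card Ws = ?M choose j" unfolding Ws_def using fin by (intro n_subsets) auto
    then show ?thesis by (simp add: Ws_def)
  qed
  also have "\<dots> \<le> (\<Sum>W\<in>Ws. \<Sum>P | partition_on W P. pmf (random_subset \<theta> ?L) (insert v ` P))"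
    using assms by (intro sum_mono discovered_set_ge) (auto simp: Ws_def)
  also have "\<dots> = (\<Sum>(W, P)\<in>Ps. pmf (random_subset \<theta> ?L) (insert v ` P))"
    unfolding Ps_def using finWs finW by (intro sum.Sigma) (auto intro: finitely_many_partition_on)
  also have "\<dots> = (\<Sum>Q\<in>(\<lambda>(W, P). insert v ` P) ` Ps. pmf (random_subset \<theta> ?L) Q)"
    using inj by (simp add: sum.reindex case_prod_unfold)
  also have "\<dots> = measure_pmf.prob (random_subset \<theta> ?L) ((\<lambda>(W, P). insert v ` P) ` Ps)"
    using finPs by (intro measure_measure_pmf_finite[symmetric]) auto
  also have "\<dots> \<le> measure_pmf.prob (random_subset \<theta> ?L) ((\<lambda>Q. card (\<Union>Q - A)) -` {j})"
  proof (intro measure_pmf.finite_measure_mono)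
    show "(\<lambda>(W, P). insert v ` P) ` Ps \<subseteq> (\<lambda>Q. card (\<Union>Q - A)) -` {j}"
    proof clarify
      fix W P assume WP: "(W, P) \<in> Ps"
      then have "\<Union>P = W" "W \<subseteq> V' - A" "card W = j" by (auto simp: Ps_def Ws_def partition_on_def)
      then have "\<Union>(insert v ` P) - A = W" using v by blast
      then show "insert v ` P \<in> (\<lambda>Q. card (\<Union>Q - A)) -` {j}" using \<open>card W = j\<close> by simp
    qed
  qed auto
  also have "\<dots> = pmf (map_pmf (\<lambda>Q. card (\<Union>Q - A)) (random_subset \<theta> ?L)) j"
    by (simp add: pmf_map)
  finally show ?thesis .
qed

end

text \<open>
  The probability that a Galton-Watson process with \<open>a\<close> ancestors has at most \<open>m\<close> individuals, by
  exploring one individual at a time: each step uses up one individual of the budget \<open>m\<close> and replaces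
  one of the \<open>a\<close> waiting individuals by its children.
\<close>

primrec total_progeny_le :: "nat pmf \<Rightarrow> nat \<Rightarrow> nat \<Rightarrow> real" where
  "total_progeny_le \<nu> 0 a = of_bool (a = 0)"
| "total_progeny_le \<nu> (Suc m) a =
     (if a = 0 then 1 else measure_pmf.expectation \<nu> (\<lambda>j. total_progeny_le \<nu> m (a + j - 1)))"

lemma total_progeny_le_0 [simp]: "total_progeny_le \<nu> m 0 = 1"
  by (cases m) auto

lemma total_progeny_le_eq_0: "m < a \<Longrightarrow> total_progeny_le \<nu> m a = 0"
proof (induction m arbitrary: a)
  case (Suc m)
  then have "total_progeny_le \<nu> m (a + j - 1) = 0" for j by (intro Suc.IH) auto
  then show ?case using Suc.prems by simp
qed simp

lemma total_progeny_le_bounds: "0 \<le> total_progeny_le \<nu> m a \<and> total_progeny_le \<nu> m a \<le> 1"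
proof (induction m arbitrary: a)
  case (Suc m)
  then have "0 \<le> measure_pmf.expectation \<nu> (\<lambda>j. total_progeny_le \<nu> m (a + j - 1))"
    by (intro integral_nonneg_AE) auto
  moreover have "measure_pmf.expectation \<nu> (\<lambda>j. total_progeny_le \<nu> m (a + j - 1)) \<le> 1"
    using Suc by (intro measure_pmf.integral_le_const integrable_bounded_pmf[where B=1])
      (auto simp: abs_le_iff intro: order_trans[of _ 0])
  ultimately show ?case by simp
qed simp

lemma card_le_reach:
  assumes "finite V" "A \<subseteq> V" "H \<subseteq> Pow V"
  shows "card A \<le> card (reach H A)" "finite (reach H A)"
proof -
  have "reach H A \<subseteq> V" using assms by (intro reach_bounded) auto
  then show "finite (reach H A)" using assms finite_subset by blast
  then show "card A \<le> card (reach H A)" using subset_reach by (intro card_mono)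
qed

context hypergraph_near_branching
begin

text \<open>
  Here \<open>V\<close> minus \<open>V'\<close> are the vertices already explored, \<open>A\<close> those discovered and waiting, and \<open>m\<close> the
  number of vertices that the component may still contain. If more vertices wait than \<open>m\<close> permits, both
  probabilities vanish; otherwise at most \<open>K\<close> vertices have been discovered, and the step changes the
  probability by at most the stated multiple of \<open>K / card V\<close>. The budget \<open>m\<close> bounds the number of steps.
\<close>

theorem prob_reach_close:
  assumes "A \<subseteq> V'" "V' \<subseteq> V" "card V - card V' + m \<le> K" "1 \<le> K"
  shows "\<bar>measure_pmf.prob (random_subset \<theta> (Pow V')) {H. card (reach H A) \<le> m}
      - total_progeny_le \<nu> m (card A)\<bar>
    \<le> real m * (real K * (2 * measure_pmf.expectation \<nu> (\<lambda>j. real j ^ 2)) / real (card V))"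
  using assms(1-3)
proof (induction m arbitrary: A V')
  case (0 A V')
  have fin: "finite V'" using 0 finite_V finite_subset by blast
  have supp: "H \<subseteq> Pow V'" if "H \<in> set_pmf (random_subset \<theta> (Pow V'))" for H
    using set_random_subset[of "Pow V'" \<theta>] fin that by blast
  have "measure_pmf.prob (random_subset \<theta> (Pow V')) {H. card (reach H A) \<le> 0} = of_bool (A = {})"
  proof (cases "A = {}")
    case False
    have "finite A" using fin 0 finite_subset by blast
    with False have "0 < card A" by (simp add: card_gt_0_iff)
    then have "card (reach H A) \<noteq> 0" if "H \<in> set_pmf (random_subset \<theta> (Pow V'))" for H
      using card_le_reach(1)[OF fin 0(1) supp[OF that]] by linarith
    then show ?thesis using False by (simp add: measure_pmf_zero_iff disjoint_iff)
  qed simp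
  moreover have "card A = 0 \<longleftrightarrow> A = {}" using finite_subset[OF 0(1) fin] by auto
  ultimately show ?case by simp
next
  case (Suc m A V')
  let ?E = "real K * (2 * measure_pmf.expectation \<nu> (\<lambda>j. real j ^ 2)) / real (card V)"
  have E0: "0 \<le> ?E" by (intro divide_nonneg_nonneg mult_nonneg_nonneg integral_nonneg_AE) auto
  have fin: "finite V'" using Suc.prems finite_V finite_subset by blast
  have finA: "finite A" using fin Suc.prems finite_subset by blast
  have supp: "H \<subseteq> Pow V'" if "H \<in> set_pmf (random_subset \<theta> (Pow V'))" for H
    using set_random_subset[of "Pow V'" \<theta>] fin that by blast
  consider "A = {}" | "Suc m < card A" | "A \<noteq> {}" "card A \<le> Suc m" by linarith
  then show ?case
  proof cases
    case 1
    then show ?thesis using E0 by simp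
  next
    case 2
    have "Suc m < card (reach H A)" if "H \<in> set_pmf (random_subset \<theta> (Pow V'))" for H
      using card_le_reach(1)[OF fin Suc.prems(1) supp[OF that]] 2 by linarith
    then have "measure_pmf.prob (random_subset \<theta> (Pow V')) {H. card (reach H A) \<le> Suc m} = 0"
      by (auto simp: measure_pmf_zero_iff disjoint_iff not_le)
    moreover have "total_progeny_le \<nu> (Suc m) (card A) = 0" using 2 by (rule total_progeny_le_eq_0)
    moreover have "0 \<le> real (Suc m) * ?E" using E0 by (intro mult_nonneg_nonneg) auto
    ultimately show ?thesis by (simp only: diff_self abs_zero)
  next
    case 3
    then obtain v where v: "v \<in> A" by blast
    then have vV: "v \<in> V" "v \<in> V'" using Suc.prems by auto
    let ?L = "{e \<in> Pow V'. v \<in> e}" and ?V = "V' - {v}"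
    let ?R = "random_subset \<theta> ?L"
    define \<phi> where "\<phi> j = total_progeny_le \<nu> m (card A + j - 1)" for j
    define new where "new Q = card (\<Union>Q - A)" for Q
    define g where "g Q = measure_pmf.prob (random_subset \<theta> (Pow ?V))
       {P. card (reach P ((A \<union> \<Union>Q) - {v})) \<le> m}" for Q
    have \<phi>: "0 \<le> \<phi> j" "\<phi> j \<le> 1" for j unfolding \<phi>_def using total_progeny_le_bounds by auto
    have g: "\<bar>g Q\<bar> \<le> 1" for Q by (simp add: g_def)
    have suppL: "Q \<subseteq> ?L" if "Q \<in> set_pmf ?R" for Q
      using set_random_subset[of ?L \<theta>] fin that by auto
    have split: "Pow ?V \<union> ?L = Pow V'" using vV by auto
    have "random_subset \<theta> (Pow ?V \<union> ?L) =
        bind_pmf ?R (\<lambda>Q. map_pmf (\<lambda>P. P \<union> Q) (random_subset \<theta> (Pow ?V)))"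
      by (rule random_subset_Un) (use fin in auto)
    then have rs: "random_subset \<theta> (Pow V') =
        bind_pmf ?R (\<lambda>Q. map_pmf (\<lambda>P. P \<union> Q) (random_subset \<theta> (Pow ?V)))"
      unfolding split .
    have "measure_pmf.prob (random_subset \<theta> (Pow V')) {H. card (reach H A) \<le> Suc m} =
        measure_pmf.expectation ?R (\<lambda>Q. measure_pmf.prob (random_subset \<theta> (Pow ?V))
          {P. card (reach (P \<union> Q) A) \<le> Suc m})"
      unfolding rs by (simp add: prob_bind_pmf vimage_def)
    also have "\<dots> = measure_pmf.expectation ?R g"
    proof (intro integral_cong_AE, force, force, unfold AE_measure_pmf_iff, intro ballI)
      fix Q assume Q: "Q \<in> set_pmf ?R"
      have "card (reach (P \<union> Q) A) = Suc (card (reach P ((A \<union> \<Union>Q) - {v})))"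
        if "P \<in> set_pmf (random_subset \<theta> (Pow ?V))" for P
      proof -
        have P: "P \<subseteq> Pow ?V" using set_random_subset[of "Pow ?V" \<theta>] fin that by blast
        have A': "(A \<union> \<Union>Q) - {v} \<subseteq> ?V" using suppL[OF Q] Suc.prems by blast
        have "reach (P \<union> Q) A = insert v (reach P ((A \<union> \<Union>Q) - {v}))"
          using v suppL[OF Q] P by (intro reach_explore) blast+
        moreover have "reach P ((A \<union> \<Union>Q) - {v}) \<subseteq> ?V" using P A' by (intro reach_bounded) auto
        then have "v \<notin> reach P ((A \<union> \<Union>Q) - {v})" by blast
        moreover have "finite (reach P ((A \<union> \<Union>Q) - {v}))"
          using fin P A' by (intro card_le_reach(2)[of ?V]) auto
        ultimately show ?thesis by simp
      qed
      then show "measure_pmf.prob (random_subset \<theta> (Pow ?V)) {P. card (reach (P \<union> Q) A) \<le> Suc m} = g Q"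
        unfolding g_def by (intro measure_pmf.finite_measure_eq_AE) (simp_all add: AE_measure_pmf_iff)
    qed
    finally have prob_eq: "measure_pmf.prob (random_subset \<theta> (Pow V')) {H. card (reach H A) \<le> Suc m}
      = measure_pmf.expectation ?R g" .
    have int_g: "integrable ?R g" using g by (rule integrable_bounded_pmf)
    have int_\<phi>: "integrable ?R (\<lambda>Q. \<phi> (new Q))"
      using \<phi> by (intro integrable_bounded_pmf[where B=1]) (simp add: abs_of_nonneg)
    have cardV: "card V' \<le> card V" "0 < card V'"
      using Suc.prems finite_V vV fin by (auto intro: card_mono simp: card_gt_0_iff)
    have cardA: "0 < card A" using v finA by (auto simp: card_gt_0_iff)
    have IH: "\<bar>g Q - \<phi> (new Q)\<bar> \<le> real m * ?E" if Q: "Q \<in> set_pmf ?R" for Q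
    proof -
      have A': "(A \<union> \<Union>Q) - {v} \<subseteq> ?V" using suppL[OF Q] Suc.prems by blast
      have "finite (\<Union>Q)" using suppL[OF Q] fin by (intro finite_subset[of "\<Union>Q" V']) auto
      moreover have "(A \<union> \<Union>Q) - {v} = (A - {v}) \<union> (\<Union>Q - A)" using v by auto
      ultimately have "card ((A \<union> \<Union>Q) - {v}) = card A + new Q - 1"
        using finA v cardA by (simp add: new_def card_Un_disjoint disjoint_iff)
      moreover have "card V - card ?V + m \<le> K"
        using Suc.prems(3) vV fin cardV by simp
      moreover have "?V \<subseteq> V" using Suc.prems by blast
      ultimately show ?thesis
        using Suc.IH[OF A'] by (simp only: g_def \<phi>_def)
    qed
    \<comment> \<open>The later steps: the induction hypothesis after the first step.\<close>
    have "\<bar>measure_pmf.expectation ?R g - measure_pmf.expectation ?R (\<lambda>Q. \<phi> (new Q))\<bar>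
        = \<bar>measure_pmf.expectation ?R (\<lambda>Q. g Q - \<phi> (new Q))\<bar>"
      using int_g int_\<phi> by simp
    also have "\<dots> \<le> measure_pmf.expectation ?R (\<lambda>Q. \<bar>g Q - \<phi> (new Q)\<bar>)"
      by (rule integral_abs_bound)
    also have "\<dots> \<le> real m * ?E"
      using int_g int_\<phi> IH
      by (intro measure_pmf.integral_le_const) (auto simp: AE_measure_pmf_iff)
    finally have step1: "\<bar>measure_pmf.expectation ?R g - measure_pmf.expectation ?R (\<lambda>Q. \<phi> (new Q))\<bar>
        \<le> real m * ?E" .
    \<comment> \<open>The present step: the law of the number of new vertices against \<open>\<nu>\<close>.\<close>
    define c where "c j = real j * (real (card V) - real (card (V' - A)) + real j) / real (card V)" for j
    have VA: "card (V' - A) \<le> card V" using cardV by (meson card_mono Diff_subset fin le_trans)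
    have cK: "c j \<le> real K * (2 * real j ^ 2) / real (card V)" and c0: "0 \<le> c j" for j
    proof -
      have "card (V' - A) = card V' - card A" using finA Suc.prems by (intro card_Diff_subset)
      then have "real (card V) - real (card (V' - A)) \<le> real K"
        using Suc.prems 3 by linarith
      then have "real (card V) - real (card (V' - A)) + real j \<le> real K * (1 + real j)"
        using \<open>1 \<le> K\<close> mult_right_mono[of 1 "real K" "real j"] by (simp add: algebra_simps)
      then have "real j * (real (card V) - real (card (V' - A)) + real j) \<le> real j * (real K * (1 + real j))"
        by (intro mult_left_mono) auto
      also have "\<dots> \<le> real K * (2 * real j ^ 2)"
      proof -
        have "real j * (1 + real j) \<le> 2 * real j ^ 2"
          by (cases j) (auto simp: power2_eq_square algebra_simps)
        then have "real K * (real j * (1 + real j)) \<le> real K * (2 * real j ^ 2)"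
          by (intro mult_left_mono) auto
        then show ?thesis by (simp add: mult_ac)
      qed
      finally show "c j \<le> real K * (2 * real j ^ 2) / real (card V)"
        unfolding c_def by (intro divide_right_mono) auto
      show "0 \<le> c j" using VA by (simp add: c_def)
    qed
    have int2: "integrable \<nu> (\<lambda>j. real K * (2 * real j ^ 2) / real (card V))"
      using \<nu>_square by (intro integrable_divide integrable_mult_right)
    have int_c: "integrable \<nu> c"
      using int2 by (rule Bochner_Integration.integrable_bound) (use cK c0 in \<open>auto simp: abs_of_nonneg\<close>)
    have "\<bar>measure_pmf.expectation (map_pmf new ?R) \<phi> - measure_pmf.expectation \<nu> \<phi>\<bar>
        \<le> measure_pmf.expectation \<nu> c"
    proof (rule expectation_diff_le_of_pmf_ge[OF _ int_c c0 \<phi>])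
      show "pmf \<nu> j * (1 - c j) \<le> pmf (map_pmf new ?R) j" for j
        unfolding c_def new_def using v Suc.prems by (intro pmf_discovered_ge) auto
    qed
    also have "\<dots> \<le> measure_pmf.expectation \<nu> (\<lambda>j. real K * (2 * real j ^ 2) / real (card V))"
      using int_c int2 cK by (intro integral_mono)
    also have "\<dots> = ?E" by simp
    finally have step2: "\<bar>measure_pmf.expectation ?R (\<lambda>Q. \<phi> (new Q)) - measure_pmf.expectation \<nu> \<phi>\<bar> \<le> ?E"
      by simp
    have "total_progeny_le \<nu> (Suc m) (card A) = measure_pmf.expectation \<nu> \<phi>"
      using cardA by (simp add: \<phi>_def[abs_def])
    moreover have "real (Suc m) * ?E = ?E + real m * ?E" by (simp only: of_nat_Suc distrib_right mult_1_left)
    ultimately show ?thesis unfolding prob_eq using step1 step2 by linarith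
  qed
qed

end

section \<open>Compound Poisson laws\<close>

definition iid_sum_pmf :: "nat \<Rightarrow> nat pmf \<Rightarrow> nat pmf" where
  "iid_sum_pmf N g = map_pmf sum_list (replicate_pmf N g)"

lemma iid_sum_pmf_0 [simp]: "iid_sum_pmf 0 g = return_pmf 0"
  by (simp add: iid_sum_pmf_def)

lemma iid_sum_pmf_Suc: "iid_sum_pmf (Suc N) g = bind_pmf g (\<lambda>x. map_pmf ((+) x) (iid_sum_pmf N g))"
  unfolding iid_sum_pmf_def replicate_pmf.simps
  by (simp add: map_pmf_def bind_assoc_pmf bind_return_pmf)

lemma pmf_bind_plus:
  fixes g q :: "nat pmf"
  shows "pmf (bind_pmf g (\<lambda>x. map_pmf ((+) x) q)) n = (\<Sum>i=0..n. pmf g i * pmf q (n - i))"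
proof -
  have shift: "pmf (map_pmf ((+) x) q) n = (if x \<le> n then pmf q (n - x) else 0)" for x
  proof (cases "x \<le> n")
    case True
    then show ?thesis using pmf_map_inj'[of "(+) x" q "n - x"] by (simp add: inj_on_def)
  next
    case False
    then show ?thesis by (auto intro: pmf_map_outside)
  qed
  have "pmf (bind_pmf g (\<lambda>x. map_pmf ((+) x) q)) n
      = (\<Sum>i\<in>{0..n}. (if i \<le> n then pmf q (n - i) else 0) * pmf g i)"
    unfolding pmf_bind shift by (intro integral_measure_pmf_real) (auto split: if_splits)
  then show ?thesis by (simp add: mult.commute)
qed

lemma pmf_iid_sum_eq_fps: "pmf (iid_sum_pmf N g) n = fps_nth (Abs_fps (pmf g) ^ N) n"
proof (induction N arbitrary: n)
  case (Suc N)
  then show ?case by (simp add: iid_sum_pmf_Suc pmf_bind_plus fps_mult_nth)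
qed simp

text \<open>
  The law of the sum has the generating function \<open>G ^ N\<close>, so this is the derivative
  \<open>(G ^ Suc N)' = Suc N * G' * G ^ N\<close> read off coefficientwise.
\<close>

lemma pmf_iid_sum_Suc_Suc:
  "real (Suc j) * pmf (iid_sum_pmf (Suc N) g) (Suc j) =
     real (Suc N) * (\<Sum>i\<le>j. real (Suc i) * pmf g (Suc i) * pmf (iid_sum_pmf N g) (j - i))"
proof -
  let ?G = "Abs_fps (pmf g)"
  have "real (Suc j) * pmf (iid_sum_pmf (Suc N) g) (Suc j) = fps_nth (fps_deriv (?G ^ Suc N)) j"
    unfolding pmf_iid_sum_eq_fps by (simp del: power_Suc)
  also have "fps_deriv (?G ^ Suc N) = fps_const (real (Suc N)) * (fps_deriv ?G * ?G ^ N)"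
    by (subst fps_deriv_power) (simp add: mult.assoc)
  also have "fps_nth \<dots> j = real (Suc N) * (\<Sum>i\<le>j. real (Suc i) * pmf g (Suc i) * pmf (iid_sum_pmf N g) (j - i))"
    by (simp add: pmf_iid_sum_eq_fps fps_mult_nth[of "fps_deriv ?G"] atLeast0AtMost)
  finally show ?thesis .
qed

lemma pmf_cpois_sums:
  assumes "0 < r"
  shows "(\<lambda>N. r ^ N / fact N * exp (- r) * pmf (iid_sum_pmf N g) j) sums pmf (cpois_pmf r g) j"
proof -
  have "pmf (cpois_pmf r g) j = measure_pmf.expectation (poisson_pmf r) (\<lambda>N. pmf (iid_sum_pmf N g) j)"
    by (simp add: cpois_pmf_def pmf_bind iid_sum_pmf_def)
  also have "\<dots> = (\<integral>N. pmf (poisson_pmf r) N * pmf (iid_sum_pmf N g) j \<partial>count_space UNIV)"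
    by (rule expectation_eq_integral_count_space)
  finally have "pmf (cpois_pmf r g) j = (\<integral>N. r ^ N / fact N * exp (- r) * pmf (iid_sum_pmf N g) j \<partial>count_space UNIV)"
    using assms by simp
  moreover have "integrable (count_space UNIV) (\<lambda>N. pmf (poisson_pmf r) N * pmf (iid_sum_pmf N g) j)"
    by (subst integrable_pmf_iff_count_space[symmetric])
       (rule integrable_bounded_pmf[where B=1], simp add: pmf_le_1)
  then have "integrable (count_space UNIV) (\<lambda>N. r ^ N / fact N * exp (- r) * pmf (iid_sum_pmf N g) j)"
    using assms by simp
  from sums_integral_count_space_nat[OF this] calculation show ?thesis by simp
qed

lemma pmf_cpois_0:
  assumes "0 < r" "pmf g 0 = 0"
  shows "pmf (cpois_pmf r g) 0 = exp (- r)"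
proof -
  have "(\<lambda>N. r ^ N / fact N * exp (- r) * pmf (iid_sum_pmf N g) 0) sums
      (\<Sum>N\<in>{0}. r ^ N / fact N * exp (- r) * pmf (iid_sum_pmf N g) 0)"
    using assms by (intro sums_finite) (auto simp: pmf_iid_sum_eq_fps fps_power_zeroth)
  from sums_unique2[OF pmf_cpois_sums[OF assms(1), of g 0] this] show ?thesis by simp
qed

text \<open>
  Panjer's recursion, obtained by averaging the previous identity over the Poisson number of
  summands: the factor \<open>Suc N\<close> cancels against the factorial and shifts the Poisson weights.
\<close>

lemma pmf_cpois_Suc:
  assumes "0 < r"
  shows "real (Suc j) * pmf (cpois_pmf r g) (Suc j) =
    (\<Sum>i\<le>j. real (Suc i) * (r * pmf g (Suc i)) * pmf (cpois_pmf r g) (j - i))"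
proof -
  let ?t = "\<lambda>N. real (Suc j) * (r ^ N / fact N * exp (- r) * pmf (iid_sum_pmf N g) (Suc j))"
  have "?t sums (real (Suc j) * pmf (cpois_pmf r g) (Suc j))"
    by (intro sums_mult pmf_cpois_sums assms)
  then have lhs: "(\<lambda>N. ?t (Suc N)) sums (real (Suc j) * pmf (cpois_pmf r g) (Suc j))"
    by (subst sums_Suc_iff) simp
  have rhs: "(\<lambda>N. \<Sum>i\<le>j. real (Suc i) * (r * pmf g (Suc i)) *
      (r ^ N / fact N * exp (- r) * pmf (iid_sum_pmf N g) (j - i))) sums
    (\<Sum>i\<le>j. real (Suc i) * (r * pmf g (Suc i)) * pmf (cpois_pmf r g) (j - i))"
    by (intro sums_sum sums_mult pmf_cpois_sums assms)
  have eq: "?t (Suc N) = (\<Sum>i\<le>j. real (Suc i) * (r * pmf g (Suc i)) *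
      (r ^ N / fact N * exp (- r) * pmf (iid_sum_pmf N g) (j - i)))" for N
  proof -
    have "?t (Suc N) = r ^ Suc N / fact (Suc N) * exp (- r) *
        (real (Suc j) * pmf (iid_sum_pmf (Suc N) g) (Suc j))"
      by (simp only: mult_ac)
    also have "\<dots> = r ^ Suc N / fact (Suc N) * exp (- r) * (real (Suc N) *
        (\<Sum>i\<le>j. real (Suc i) * pmf g (Suc i) * pmf (iid_sum_pmf N g) (j - i)))"
      by (simp only: pmf_iid_sum_Suc_Suc)
    also have "\<dots> = r * (r ^ N / fact N * exp (- r)) *
        (\<Sum>i\<le>j. real (Suc i) * pmf g (Suc i) * pmf (iid_sum_pmf N g) (j - i))"
      by (simp add: divide_simps del: of_nat_Suc)
    finally show ?thesis by (simp only: sum_distrib_left mult_ac)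
  qed
  have "(\<lambda>N. ?t (Suc N)) sums
    (\<Sum>i\<le>j. real (Suc i) * (r * pmf g (Suc i)) * pmf (cpois_pmf r g) (j - i))"
    unfolding eq by (rule rhs)
  with lhs show ?thesis by (rule sums_unique2)
qed

lemma pmf_geometric_pos:
  assumes "0 < p" "p \<le> 1"
  shows "pmf (geometric_pos_pmf p) 0 = 0" "pmf (geometric_pos_pmf p) (Suc k) = (1 - p) ^ k * p"
proof -
  show "pmf (geometric_pos_pmf p) 0 = 0"
    unfolding geometric_pos_pmf_def by (intro pmf_map_outside) auto
  show "pmf (geometric_pos_pmf p) (Suc k) = (1 - p) ^ k * p"
    unfolding geometric_pos_pmf_def using assms by (subst pmf_map_inj') auto
qed

lemma nn_integral_power_iid_sum:
  fixes z :: ennreal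
  shows "(\<integral>\<^sup>+s. z ^ s \<partial>measure_pmf (iid_sum_pmf N g)) = (\<integral>\<^sup>+k. z ^ k \<partial>measure_pmf g) ^ N"
proof (induction N)
  case (Suc N)
  then show ?case
    by (simp add: iid_sum_pmf_Suc power_add nn_integral_cmult nn_integral_multc)
qed simp

text \<open>
  Given \<open>N\<close> summands the moment is the \<open>N\<close>-th power of that of one summand, and a Poisson variable
  has all exponential moments.
\<close>

lemma cpois_exponential_moment:
  fixes z :: real
  assumes r: "0 < r" and z: "0 \<le> z" and g: "integrable (measure_pmf g) (\<lambda>k. z ^ k)"
  shows "integrable (measure_pmf (cpois_pmf r g)) (\<lambda>k. z ^ k)"
proof -
  define b where "b = measure_pmf.expectation g (\<lambda>k. z ^ k)"
  have b0: "0 \<le> b" unfolding b_def by (rule Bochner_Integration.integral_nonneg) (use z in simp)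
  have gb: "(\<integral>\<^sup>+k. ennreal z ^ k \<partial>measure_pmf g) = ennreal b"
    unfolding b_def using g z by (simp add: ennreal_power nn_integral_eq_integral)
  have "summable (\<lambda>N. b ^ N * (r ^ N / fact N * exp (- r)))"
  proof -
    have "summable (\<lambda>N. exp (- r) * (inverse (fact N) * (b * r) ^ N))"
      by (intro summable_mult summable_exp)
    then show ?thesis by (simp add: power_mult_distrib divide_inverse mult_ac)
  qed
  then have "integrable (measure_pmf (poisson_pmf r)) (\<lambda>N. b ^ N)"
    using r b0 by (simp add: integrable_pmf_iff_count_space integrable_count_space_nat_iff mult_ac)
  then have fin: "(\<integral>\<^sup>+N. ennreal (b ^ N) \<partial>measure_pmf (poisson_pmf r)) < \<infinity>"
    using b0 by (subst nn_integral_eq_integral) auto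
  have "(\<integral>\<^sup>+k. ennreal (z ^ k) \<partial>measure_pmf (cpois_pmf r g)) =
      (\<integral>\<^sup>+N. (\<integral>\<^sup>+s. ennreal z ^ s \<partial>measure_pmf (iid_sum_pmf N g)) \<partial>measure_pmf (poisson_pmf r))"
    using z by (simp add: cpois_pmf_def iid_sum_pmf_def ennreal_power)
  also have "\<dots> < \<infinity>"
    using fin b0 by (simp only: nn_integral_power_iid_sum gb ennreal_power)
  finally show ?thesis using z by (intro integrableI_nonneg) auto
qed

lemma integrable_square_of_exponential_moment:
  fixes z :: real
  assumes "1 < z" "integrable (measure_pmf \<nu>) (\<lambda>k. z ^ k)"
  shows "integrable (measure_pmf \<nu>) (\<lambda>k. real k ^ 2)"
proof (rule Bochner_Integration.integrable_bound)
  \<comment> \<open>Bernoulli's inequality for the base \<open>1 + d = sqrt z\<close>, squared, bounds \<open>k\<^sup>2\<close> by a multiple of \<open>z ^ k\<close>.\<close>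
  define d where "d = sqrt z - 1"
  have d: "0 < d" using assms by (simp add: d_def)
  show "integrable (measure_pmf \<nu>) (\<lambda>k. z ^ k / d ^ 2)"
    using assms by (intro integrable_divide)
  have "real k ^ 2 \<le> z ^ k / d ^ 2" for k
  proof -
    have "real k * d \<le> 1 + real k * d" by simp
    also have "\<dots> \<le> (1 + d) ^ k" using d by (intro Bernoulli_inequality) auto
    finally have "(real k * d) ^ 2 \<le> ((1 + d) ^ k) ^ 2" using d by (intro power_mono) auto
    also have "\<dots> = z ^ k"
      using assms by (simp add: d_def power_mult[symmetric] mult.commute[of k 2] power_mult)
    finally show ?thesis using d by (simp add: power_mult_distrib field_simps)
  qed
  then show "AE k in measure_pmf \<nu>. norm (real k ^ 2) \<le> norm (z ^ k / d ^ 2)"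
    using assms by auto
qed auto

lemma cpois_geometric_square_integrable:
  assumes "0 < r" "0 < p" "p < 1"
  shows "integrable (measure_pmf (cpois_pmf r (geometric_pos_pmf p))) (\<lambda>k. real k ^ 2)"
proof (rule integrable_square_of_exponential_moment)
  \<comment> \<open>Any \<open>z > 1\<close> with \<open>(1 - p) * z < 1\<close> will do.\<close>
  define z where "z = (1 - p / 2) / (1 - p)"
  show z1: "1 < z" using assms by (simp add: z_def field_simps)
  have zp: "(1 - p) * z = 1 - p / 2" using assms by (simp add: z_def)
  have "summable (\<lambda>k. p * z * ((1 - p) * z) ^ k)"
    unfolding zp using assms by (intro summable_mult summable_geometric) auto
  then have "integrable (measure_pmf (geometric_pmf p)) (\<lambda>k. z ^ Suc k)"
    using assms z1
    by (simp add: integrable_pmf_iff_count_space integrable_count_space_nat_iff power_mult_distrib mult_ac)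
  then have "integrable (measure_pmf (geometric_pos_pmf p)) (\<lambda>k. z ^ k)"
    by (simp add: geometric_pos_pmf_def)
  then show "integrable (measure_pmf (cpois_pmf r (geometric_pos_pmf p))) (\<lambda>k. z ^ k)"
    using assms z1 by (intro cpois_exponential_moment) auto
qed

section \<open>Total progeny of a Galton-Watson process\<close>

lemma expectation_bind_pmf:
  fixes f :: "'b \<Rightarrow> real"
  assumes "\<And>x. \<bar>f x\<bar> \<le> B"
  shows "measure_pmf.expectation (bind_pmf M N) f = measure_pmf.expectation M (\<lambda>x. measure_pmf.expectation (N x) f)"
  unfolding measure_pmf_bind
  by (rule integral_bind[where K="count_space UNIV" and B=B and B'=1])
     (use assms in \<open>auto simp: space_subprob_algebra prob_space_imp_subprob_space
        measure_pmf.prob_space_axioms measure_pmf.finite_measure_axioms measure_pmf.emeasure_space_1\<close>)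

text \<open>
  Exploring \<open>a\<close> individuals one after the other, while \<open>b\<close> others wait, replaces them by the sum of \<open>a\<close>
  independent offspring numbers. For \<open>b = 0\<close> this explores a whole generation.
\<close>

lemma total_progeny_le_iid_sum:
  "measure_pmf.expectation (iid_sum_pmf a \<nu>) (\<lambda>s. total_progeny_le \<nu> m (b + s)) =
     total_progeny_le \<nu> (m + a) (a + b)"
proof (induction a arbitrary: b)
  case (Suc a)
  have "measure_pmf.expectation (iid_sum_pmf (Suc a) \<nu>) (\<lambda>s. total_progeny_le \<nu> m (b + s)) =
      measure_pmf.expectation \<nu> (\<lambda>j. measure_pmf.expectation (iid_sum_pmf a \<nu>) (\<lambda>s. total_progeny_le \<nu> m (b + j + s)))"
    unfolding iid_sum_pmf_Suc using total_progeny_le_bounds[of \<nu> m]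
    by (subst expectation_bind_pmf[where B=1]) (auto simp: abs_of_nonneg add.assoc)
  also have "\<dots> = total_progeny_le \<nu> (m + Suc a) (Suc a + b)"
    unfolding Suc.IH by (simp add: add.assoc)
  finally show ?case .
qed simp

lemma measurable_add_nat:
  fixes f g :: "'a \<Rightarrow> nat"
  assumes "f \<in> measurable M (count_space UNIV)" "g \<in> measurable M (count_space UNIV)"
  shows "(\<lambda>x. f x + g x) \<in> measurable M (count_space UNIV)"
  using assms(1)
  by (rule measurable_compose_countable[rotated])
     (rule measurable_compose[OF assms(2)], simp)

lemma measurable_sum_nat:
  fixes f :: "'i \<Rightarrow> 'a \<Rightarrow> nat"
  assumes "finite I" "\<And>i. i \<in> I \<Longrightarrow> f i \<in> measurable M (count_space UNIV)"
  shows "(\<lambda>x. \<Sum>i\<in>I. f i x) \<in> measurable M (count_space UNIV)"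
  using assms by (induction I rule: finite_induct) (auto intro!: measurable_add_nat)

lemma measurable_gw_generation:
  assumes "\<And>gi. Y gi \<in> measurable M (count_space UNIV)"
  shows "(\<lambda>\<omega>. gw_generation u (\<lambda>gi. Y gi \<omega>) g) \<in> measurable M (count_space UNIV)"
proof (induction g)
  case (Suc g)
  show ?case unfolding gw_generation.simps
    by (rule measurable_compose_countable[OF _ Suc]) (intro measurable_sum_nat assms finite_lessThan)
qed simp

lemma gw_generation_shift:
  "gw_generation u \<xi> (Suc g) = gw_generation (\<Sum>i<u. \<xi> (0, i)) (\<lambda>(g, i). \<xi> (Suc g, i)) g"
  by (induction g) auto

lemma gw_generation_0 [simp]: "gw_generation 0 \<xi> g = 0"
  by (induction g) auto

text \<open>
  This separates one individual of a row from the others, and a generation from the later ones.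
\<close>

lemma (in prob_space) prob_indep_restrict:
  assumes ind: "indep_vars (\<lambda>_. count_space UNIV) X UNIV" and AB: "A \<inter> B = {}"
    and P: "Measurable.pred (PiM A (\<lambda>_. count_space UNIV)) P"
    and Q: "Measurable.pred (PiM B (\<lambda>_. count_space UNIV)) Q"
  shows "prob {\<omega> \<in> space M. P (\<lambda>i\<in>A. X i \<omega>) \<and> Q (\<lambda>i\<in>B. X i \<omega>)} =
    prob {\<omega> \<in> space M. P (\<lambda>i\<in>A. X i \<omega>)} * prob {\<omega> \<in> space M. Q (\<lambda>i\<in>B. X i \<omega>)}"
proof -
  let ?A = "PiM A (\<lambda>_. count_space UNIV)" and ?B = "PiM B (\<lambda>_. count_space UNIV)"
  have iv: "indep_var ?A (\<lambda>\<omega>. \<lambda>i\<in>A. X i \<omega>) ?B (\<lambda>\<omega>. \<lambda>i\<in>B. X i \<omega>)"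
    by (rule indep_var_restrict[OF ind AB]) auto
  have "prob ((\<lambda>\<omega>. (\<lambda>i\<in>A. X i \<omega>, \<lambda>i\<in>B. X i \<omega>)) -` ({x \<in> space ?A. P x} \<times> {x \<in> space ?B. Q x}) \<inter> space M) =
      prob ((\<lambda>\<omega>. \<lambda>i\<in>A. X i \<omega>) -` {x \<in> space ?A. P x} \<inter> space M) *
      prob ((\<lambda>\<omega>. \<lambda>i\<in>B. X i \<omega>) -` {x \<in> space ?B. Q x} \<inter> space M)"
    using iv P Q by (intro indep_varD) (auto simp: pred_def)
  then show ?thesis
    by (simp add: space_PiM vimage_def Int_def conj_commute)
qed

lemma (in prob_space) prob_offspring_sum:
  fixes X :: "nat \<times> nat \<Rightarrow> 'a \<Rightarrow> nat"
  assumes ind: "indep_vars (\<lambda>_. count_space UNIV) X UNIV"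
    and law: "\<And>gi j. prob {\<omega> \<in> space M. X gi \<omega> = j} = pmf \<nu> j"
  shows "prob {\<omega> \<in> space M. (\<Sum>i<a. X (k, i) \<omega>) = s} = pmf (iid_sum_pmf a \<nu>) s"
proof (induction a arbitrary: s)
  case 0
  then show ?case by (cases "s = 0") (simp_all add: prob_space)
next
  case (Suc a)
  have X[measurable]: "X gi \<in> measurable M (count_space UNIV)" for gi
    using ind unfolding indep_vars_def by blast
  have S[measurable]: "(\<lambda>\<omega>. \<Sum>i<a. X (k, i) \<omega>) \<in> measurable M (count_space UNIV)"
    by (intro measurable_sum_nat X) auto
  let ?E = "\<lambda>j. {\<omega> \<in> space M. X (k, a) \<omega> = j \<and> (\<Sum>i<a. X (k, i) \<omega>) = s - j}"
  have "{\<omega> \<in> space M. (\<Sum>i<Suc a. X (k, i) \<omega>) = s} = (\<Union>j\<in>{0..s}. ?E j)"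
    by auto
  then have "prob {\<omega> \<in> space M. (\<Sum>i<Suc a. X (k, i) \<omega>) = s} = (\<Sum>j=0..s. prob (?E j))"
    by (simp only:) (intro finite_measure_finite_Union, auto simp: disjoint_family_on_def)
  also have "\<dots> = (\<Sum>j=0..s. pmf \<nu> j * pmf (iid_sum_pmf a \<nu>) (s - j))"
  proof (intro sum.cong refl)
    fix j
    let ?A = "{(k, a)}" and ?B = "{k} \<times> {..<a}"
    have "prob {\<omega> \<in> space M. (\<lambda>i\<in>?A. X i \<omega>) (k, a) = j \<and> (\<Sum>i<a. (\<lambda>i\<in>?B. X i \<omega>) (k, i)) = s - j} =
        prob {\<omega> \<in> space M. (\<lambda>i\<in>?A. X i \<omega>) (k, a) = j} *
        prob {\<omega> \<in> space M. (\<Sum>i<a. (\<lambda>i\<in>?B. X i \<omega>) (k, i)) = s - j}"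
    proof (rule prob_indep_restrict[OF ind])
      have "(\<lambda>x. \<Sum>i<a. x (k, i) :: nat) \<in> measurable (PiM ?B (\<lambda>_. count_space UNIV)) (count_space UNIV)"
        by (intro measurable_sum_nat measurable_component_singleton) auto
      then show "Measurable.pred (PiM ?B (\<lambda>_. count_space UNIV)) (\<lambda>x. (\<Sum>i<a. x (k, i)) = s - j)"
        by measurable
      have "(\<lambda>x. x (k, a) :: nat) \<in> measurable (PiM ?A (\<lambda>_. count_space UNIV)) (count_space UNIV)"
        by (intro measurable_component_singleton) auto
      then show "Measurable.pred (PiM ?A (\<lambda>_. count_space UNIV)) (\<lambda>x. x (k, a) = j)"
        by measurable
    qed auto
    then show "prob (?E j) = pmf \<nu> j * pmf (iid_sum_pmf a \<nu>) (s - j)"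
      by (simp add: law Suc.IH)
  qed
  also have "\<dots> = pmf (iid_sum_pmf (Suc a) \<nu>) s"
    by (simp add: iid_sum_pmf_Suc pmf_bind_plus)
  finally show ?case .
qed

text \<open>
  The process begun at generation \<open>k\<close> of the array is treated for all \<open>k\<close> at once, since
  the induction passes from generation \<open>k\<close> to generation \<open>k + 1\<close>. With \<open>G > m\<close> generations a total of at
  most \<open>m\<close> forces extinction among them. The ancestors lower the budget from \<open>m\<close> to \<open>m - a\<close>,
  which is smaller unless \<open>a = 0\<close>.
\<close>

lemma (in prob_space) prob_gw_partial_total:
  fixes X :: "nat \<times> nat \<Rightarrow> 'a \<Rightarrow> nat"
  assumes ind: "indep_vars (\<lambda>_. count_space UNIV) X UNIV"
    and law: "\<And>gi j. prob {\<omega> \<in> space M. X gi \<omega> = j} = pmf \<nu> j"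
    and "m < G"
  shows "prob {\<omega> \<in> space M. (\<Sum>g<G. gw_generation a (\<lambda>(g, i). X (k + g, i) \<omega>) g) \<le> m} = total_progeny_le \<nu> m a"
  using assms(3)
proof (induction m arbitrary: k a G rule: less_induct)
  case (less m k a G)
  from less.prems obtain G' where G': "G = Suc G'" "m \<le> G'" by (cases G) auto
  have tot: "(\<Sum>g<G. gw_generation a \<xi> g) =
      a + (\<Sum>g<G'. gw_generation (\<Sum>i<a. \<xi> (0, i)) (\<lambda>(g, i). \<xi> (Suc g, i)) g)" for \<xi>
    unfolding G' sum.lessThan_Suc_shift gw_generation_shift by simp
  consider "a = 0" | "m < a" | "0 < a" "a \<le> m" by linarith
  then show ?case
  proof cases
    case 1
    then show ?thesis by (simp add: prob_space)
  next
    case 2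
    then show ?thesis unfolding tot by (simp add: total_progeny_le_eq_0)
  next
    case 3
    have X[measurable]: "X gi \<in> measurable M (count_space UNIV)" for gi
      using ind unfolding indep_vars_def by blast
    let ?T = "\<lambda>s \<omega>. \<Sum>g<G'. gw_generation s (\<lambda>(g, i). X (Suc k + g, i) \<omega>) g"
    have T[measurable]: "?T s \<in> measurable M (count_space UNIV)" for s
      by (auto intro!: measurable_sum_nat measurable_gw_generation simp: case_prod_unfold)
    have S[measurable]: "(\<lambda>\<omega>. \<Sum>i<a. X (k, i) \<omega>) \<in> measurable M (count_space UNIV)"
      by (intro measurable_sum_nat X) auto
    let ?E = "\<lambda>s. {\<omega> \<in> space M. (\<Sum>i<a. X (k, i) \<omega>) = s \<and> ?T s \<omega> \<le> m - a}"
    have Em: "?E s \<in> events" for s by measurable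
    have sT: "s \<le> ?T s \<omega>" for s \<omega>
      using member_le_sum[of 0 "{..<G'}" "gw_generation s (\<lambda>(g, i). X (Suc k + g, i) \<omega>)"] 3 G' by simp
    have "{\<omega> \<in> space M. (\<Sum>g<G. gw_generation a (\<lambda>(g, i). X (k + g, i) \<omega>) g) \<le> m} = (\<Union>s\<in>{..m - a}. ?E s)"
    proof -
      have "(\<Sum>g<G. gw_generation a (\<lambda>(g, i). X (k + g, i) \<omega>) g) = a + ?T (\<Sum>i<a. X (k, i) \<omega>) \<omega>" for \<omega>
        unfolding tot by simp
      then have "(\<Sum>g<G. gw_generation a (\<lambda>(g, i). X (k + g, i) \<omega>) g) \<le> m \<longleftrightarrow>
          (\<Sum>i<a. X (k, i) \<omega>) \<le> m - a \<and> ?T (\<Sum>i<a. X (k, i) \<omega>) \<omega> \<le> m - a" for \<omega>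
        using 3 sT[of "\<Sum>i<a. X (k, i) \<omega>" \<omega>] by (simp only:) linarith
      then show ?thesis by auto
    qed
    then have "prob {\<omega> \<in> space M. (\<Sum>g<G. gw_generation a (\<lambda>(g, i). X (k + g, i) \<omega>) g) \<le> m} = (\<Sum>s\<le>m - a. prob (?E s))"
    proof (simp only:, intro finite_measure_finite_Union)
      show "?E ` {..m - a} \<subseteq> events" using Em by blast
    qed (auto simp: disjoint_family_on_def)
    also have "\<dots> = (\<Sum>s\<le>m - a. total_progeny_le \<nu> (m - a) s * pmf (iid_sum_pmf a \<nu>) s)"
    proof (intro sum.cong refl)
      fix s :: nat
      let ?A = "{k} \<times> {..<a}" and ?B = "{k<..} \<times> (UNIV :: nat set)"
      let ?P = "\<lambda>x. (\<Sum>i<a. x (k, i)) = s"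
      let ?Q = "\<lambda>x. (\<Sum>g<G'. gw_generation s (\<lambda>gi. x (Suc k + fst gi, snd gi)) g) \<le> m - a"
      have "prob {\<omega> \<in> space M. ?P (\<lambda>i\<in>?A. X i \<omega>) \<and> ?Q (\<lambda>i\<in>?B. X i \<omega>)} =
        prob {\<omega> \<in> space M. ?P (\<lambda>i\<in>?A. X i \<omega>)} * prob {\<omega> \<in> space M. ?Q (\<lambda>i\<in>?B. X i \<omega>)}"
      proof (rule prob_indep_restrict[OF ind])
        have "(\<lambda>x. \<Sum>i<a. x (k, i) :: nat) \<in> measurable (PiM ?A (\<lambda>_. count_space UNIV)) (count_space UNIV)"
          by (intro measurable_sum_nat measurable_component_singleton) auto
        then show "Measurable.pred (PiM ?A (\<lambda>_. count_space UNIV)) ?P"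
          by measurable
        have "(\<lambda>x. \<Sum>g<G'. gw_generation s (\<lambda>gi. x (Suc k + fst gi, snd gi)) g)
            \<in> measurable (PiM ?B (\<lambda>_. count_space UNIV)) (count_space UNIV)"
          by (intro measurable_sum_nat measurable_gw_generation measurable_component_singleton) auto
        then show "Measurable.pred (PiM ?B (\<lambda>_. count_space UNIV)) ?Q"
          by measurable
      qed auto
      then have "prob (?E s) = prob {\<omega> \<in> space M. (\<Sum>i<a. X (k, i) \<omega>) = s} * prob {\<omega> \<in> space M. ?T s \<omega> \<le> m - a}"
        by (simp add: case_prod_unfold)
      also have "\<dots> = pmf (iid_sum_pmf a \<nu>) s * total_progeny_le \<nu> (m - a) s"
        using 3 G' by (subst prob_offspring_sum[OF ind law], subst less.IH) auto
      finally show "prob (?E s) = total_progeny_le \<nu> (m - a) s * pmf (iid_sum_pmf a \<nu>) s"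
        by simp
    qed
    also have "\<dots> = measure_pmf.expectation (iid_sum_pmf a \<nu>) (total_progeny_le \<nu> (m - a))"
    proof (rule integral_measure_pmf_real[symmetric])
      show "s \<in> {..m - a}" if "total_progeny_le \<nu> (m - a) s \<noteq> 0" for s
        using that total_progeny_le_eq_0[of "m - a" s \<nu>] by (cases "s \<le> m - a") auto
    qed simp
    also have "\<dots> = total_progeny_le \<nu> m a"
      using total_progeny_le_iid_sum[of a \<nu> "m - a" 0] 3 by simp
    finally show ?thesis .
  qed
qed

text \<open>
  Among \<open>m + 1\<close> generations with at most \<open>m\<close> individuals one is empty, and then all later ones are.
\<close>

lemma gw_total_le_iff: "gw_total u \<xi> \<le> enat m \<longleftrightarrow> (\<Sum>g<Suc m. gw_generation u \<xi> g) \<le> m"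
proof
  assume "gw_total u \<xi> \<le> enat m"
  moreover have "(\<Sum>g<Suc m. enat (gw_generation u \<xi> g)) \<le> gw_total u \<xi>"
    unfolding gw_total_def by (rule sum_le_suminf) (auto intro: summableI)
  moreover have "(\<Sum>g<Suc m. enat (gw_generation u \<xi> g)) = enat (\<Sum>g<Suc m. gw_generation u \<xi> g)"
    by (simp only: of_nat_eq_enat[symmetric] of_nat_sum)
  ultimately show "(\<Sum>g<Suc m. gw_generation u \<xi> g) \<le> m" by (metis enat_ord_simps(1) order_trans)
next
  assume le: "(\<Sum>g<Suc m. gw_generation u \<xi> g) \<le> m"
  have "\<exists>g<Suc m. gw_generation u \<xi> g = 0"
  proof (rule ccontr)
    assume "\<not> ?thesis"
    then have "(\<Sum>g<Suc m. 1) \<le> (\<Sum>g<Suc m. gw_generation u \<xi> g)" by (intro sum_mono) auto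
    with le show False by simp
  qed
  then obtain g0 where g0: "g0 < Suc m" "gw_generation u \<xi> g0 = 0" by blast
  have "gw_generation u \<xi> (g0 + d) = 0" for d by (induction d) (use g0 in auto)
  then have zero: "gw_generation u \<xi> g = 0" if "\<not> g < Suc m" for g
    using that g0 le_add_diff_inverse[of g0 g] by (metis less_or_eq_imp_le not_less order_trans)
  have "gw_total u \<xi> = (\<Sum>g<Suc m. enat (gw_generation u \<xi> g))"
    unfolding gw_total_def using zero by (intro suminf_finite) (auto simp: zero_enat_def)
  also have "\<dots> = enat (\<Sum>g<Suc m. gw_generation u \<xi> g)"
    by (simp only: of_nat_eq_enat[symmetric] of_nat_sum)
  finally show "gw_total u \<xi> \<le> enat m" using le by simp
qed

lemma prob_gw_total:
  "measure (gw_space \<nu>) {\<xi> \<in> space (gw_space \<nu>). gw_total u \<xi> \<le> enat m} = total_progeny_le \<nu> m u"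
proof -
  interpret gw: prob_space "gw_space \<nu>"
    unfolding gw_space_def by (intro prob_space_PiM measure_pmf.prob_space_axioms)
  let ?X = "\<lambda>gi (\<xi> :: nat \<times> nat \<Rightarrow> nat). \<xi> gi"
  have comp: "?X gi \<in> measurable (gw_space \<nu>) (count_space UNIV)" for gi
    unfolding gw_space_def
    using measurable_component_singleton[of gi UNIV "\<lambda>_. measure_pmf \<nu>"] by simp
  have distr: "distr (gw_space \<nu>) (count_space UNIV) (?X gi) = measure_pmf \<nu>" for gi
  proof -
    have "distr (gw_space \<nu>) (measure_pmf \<nu>) (?X gi) = measure_pmf \<nu>"
      unfolding gw_space_def by (rule distr_PiM_component) (auto intro: measure_pmf.prob_space_axioms)
    moreover have "distr (gw_space \<nu>) (measure_pmf \<nu>) (?X gi) = distr (gw_space \<nu>) (count_space UNIV) (?X gi)"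
      by (rule distr_cong) auto
    ultimately show ?thesis by simp
  qed
  have "gw.indep_vars (\<lambda>_. count_space UNIV) ?X UNIV"
  proof (subst gw.indep_vars_iff_distr_eq_PiM)
    have "distr (gw_space \<nu>) (Pi\<^sub>M UNIV (\<lambda>_. count_space UNIV)) (\<lambda>x. \<lambda>i\<in>UNIV. x i)
      = distr (gw_space \<nu>) (gw_space \<nu>) (\<lambda>x. x)"
      by (rule distr_cong) (auto simp: gw_space_def intro!: sets_PiM_cong)
    also have "\<dots> = gw_space \<nu>" by (rule distr_id2) simp
    finally show "distr (gw_space \<nu>) (Pi\<^sub>M UNIV (\<lambda>_. count_space UNIV)) (\<lambda>x. \<lambda>i\<in>UNIV. x i)
       = Pi\<^sub>M UNIV (\<lambda>i. distr (gw_space \<nu>) (count_space UNIV) (?X i))"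
      unfolding distr by (simp add: gw_space_def)
  qed (use comp in auto)
  moreover have "gw.prob {\<xi> \<in> space (gw_space \<nu>). ?X gi \<xi> = j} = pmf \<nu> j" for gi j
  proof -
    have "pmf \<nu> j = measure (distr (gw_space \<nu>) (count_space UNIV) (?X gi)) {j}"
      unfolding distr by (simp add: pmf.rep_eq)
    also have "\<dots> = gw.prob {\<xi> \<in> space (gw_space \<nu>). ?X gi \<xi> = j}"
      using comp by (subst measure_distr) (auto simp: vimage_def Int_def conj_commute)
    finally show ?thesis by simp
  qed
  ultimately show ?thesis
    unfolding gw_total_le_iff using gw.prob_gw_partial_total[of ?X \<nu> m "Suc m" u 0] by (simp add: case_prod_unfold)
qed

section \<open>The loop measure and supports of loops\<close>

lemma equiv_loop_rel: "equiv (based_loops n) (loop_rel n)"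
proof (rule equivI)
  show "loop_rel n \<subseteq> based_loops n \<times> based_loops n" by (auto simp: loop_rel_def)
  show "refl_on (based_loops n) (loop_rel n)"
    by (rule refl_onI) (auto simp: loop_rel_def intro: exI[of _ 0])
  show "sym (loop_rel n)"
  proof (rule symI)
    fix xs ys assume "(xs, ys) \<in> loop_rel n"
    then obtain m where m: "xs \<in> based_loops n" "ys \<in> based_loops n" "ys = rotate m xs"
      by (auto simp: loop_rel_def)
    have "m * (length xs - 1) + m = length xs * m"
      using m(1) by (cases xs) (auto simp: based_loops_def algebra_simps)
    then have "rotate (m * (length xs - 1)) ys = rotate (length xs * m) xs"
      using m(3) by (simp add: rotate_rotate)
    also have "\<dots> = xs" by (subst rotate_conv_mod) simp
    finally have "xs = rotate (m * (length xs - 1)) ys" by simp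
    with m show "(ys, xs) \<in> loop_rel n" by (auto simp: loop_rel_def)
  qed
  show "trans (loop_rel n)"
    by (rule transI) (auto simp: loop_rel_def rotate_rotate)
qed

lemma DL_same_length_set:
  assumes "l \<in> DL n" "xs \<in> l" "ys \<in> l"
  shows "length ys = length xs" "set ys = set xs"
proof -
  have "(xs, ys) \<in> loop_rel n"
    using assms quotient_eq_iff[OF equiv_loop_rel, of l n l xs ys] by (auto simp: DL_def)
  then show "length ys = length xs" "set ys = set xs" by (auto simp: loop_rel_def)
qed

lemma DL_disjoint: "l \<in> DL n \<Longrightarrow> l' \<in> DL n \<Longrightarrow> l \<noteq> l' \<Longrightarrow> l \<inter> l' = {}"
  using quotient_disj[OF equiv_loop_rel, of l n l'] by (auto simp: DL_def)

lemma DL_subset: "l \<in> DL n \<Longrightarrow> l \<subseteq> {xs. set xs \<subseteq> {1..n} \<and> 2 \<le> length xs}"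
  using in_quotient_imp_subset[OF equiv_loop_rel, of l n] by (auto simp: DL_def based_loops_def)

lemma DL_nonempty: "l \<in> DL n \<Longrightarrow> l \<noteq> {}"
  using in_quotient_imp_non_empty[OF equiv_loop_rel, of l n] by (auto simp: DL_def)

lemma finite_DL: 
  assumes "l \<in> DL n"
  shows "finite l"
proof -
  obtain xs where xs: "xs \<in> l" using DL_nonempty[OF assms] by blast
  have "l \<subseteq> {ys. set ys \<subseteq> {1..n} \<and> length ys = length xs}"
    using DL_subset[OF assms] DL_same_length_set(1)[OF assms xs] by blast
  then show ?thesis by (rule finite_subset) (simp add: finite_lists_length_eq)
qed

lemma DL_class:
  assumes "set xs \<subseteq> {1..n}" "2 \<le> length xs"
  shows "loop_rel n `` {xs} \<in> DL n" "xs \<in> loop_rel n `` {xs}"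
proof -
  have xs: "xs \<in> based_loops n" using assms by (auto simp: based_loops_def)
  show "xs \<in> loop_rel n `` {xs}" using equiv_class_self[OF equiv_loop_rel xs] .
  have "loop_rel n `` {xs} \<in> based_loops n // loop_rel n" using xs by (rule quotientI)
  moreover have "length ys = length xs" if "ys \<in> loop_rel n `` {xs}" for ys
    using that by (auto simp: loop_rel_def)
  ultimately show "loop_rel n `` {xs} \<in> DL n" using assms by (auto simp: DL_def)
qed

lemma countable_DL: "countable (DL n)"
proof -
  have "DL n \<subseteq> (\<lambda>xs. loop_rel n `` {xs}) ` UNIV" by (auto simp: DL_def quotient_def)
  then show ?thesis by (rule countable_subset) simp
qed

definition loop_support :: "nat list set \<Rightarrow> nat set" where
  "loop_support l = \<Union>(set ` l)"

lemma loop_support_eq: "l \<in> DL n \<Longrightarrow> xs \<in> l \<Longrightarrow> loop_support l = set xs"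
  using DL_same_length_set(2)[of l n xs] unfolding loop_support_def by blast

lemma based_weight_eq:
  "based_weight \<epsilon> n xs = (1 / (real n * (\<epsilon> + 1))) ^ length xs / real (length xs)"
  by (simp add: based_weight_def trans_prob_def)

lemma emeasure_loop_measure_finite:
  assumes "finite X" "X \<subseteq> DL n"
  shows "emeasure (loop_measure \<epsilon> n) X = (\<Sum>xs\<in>\<Union>X. ennreal (based_weight \<epsilon> n xs))"
proof -
  have "emeasure (loop_measure \<epsilon> n) X = (\<Sum>l\<in>X. \<Sum>xs\<in>l. ennreal (based_weight \<epsilon> n xs))"
    unfolding loop_measure_def using assms by (intro emeasure_point_measure_finite2)
  also have "\<dots> = (\<Sum>xs\<in>\<Union>X. ennreal (based_weight \<epsilon> n xs))"
  proof (subst sum.Union_disjoint)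
    show "\<forall>l\<in>X. finite l" using assms finite_DL by blast
    show "\<forall>l\<in>X. \<forall>l'\<in>X. l \<noteq> l' \<longrightarrow> l \<inter> l' = {}" using assms DL_disjoint by blast
  qed (simp add: o_def)
  finally show ?thesis .
qed

lemma sets_loop_measure: "sets (loop_measure \<epsilon> n) = Pow (DL n)"
  by (simp add: loop_measure_def sets_point_measure)

lemma space_loop_measure: "space (loop_measure \<epsilon> n) = DL n"
  by (simp add: loop_measure_def space_point_measure)

lemma card_lists_through_le:
  assumes "v \<in> {1..n}"
  shows "real (card {xs. set xs \<subseteq> {1..n} \<and> length xs = k \<and> v \<in> set xs}) \<le> real k * real n ^ k / real n"
proof -
  have n: "0 < n" using assms by auto
  let ?L = "\<lambda>A. {xs. set xs \<subseteq> A \<and> length xs = k}"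
  have "{xs. set xs \<subseteq> {1..n} \<and> length xs = k \<and> v \<in> set xs} = ?L {1..n} - ?L ({1..n} - {v})"
    by auto
  moreover have "card (?L {1..n} - ?L ({1..n} - {v})) = card (?L {1..n}) - card (?L ({1..n} - {v}))"
    by (intro card_Diff_subset finite_lists_length_eq) auto
  moreover have "card (?L {1..n}) = n ^ k" "card (?L ({1..n} - {v})) = (n - 1) ^ k"
    using assms by (simp_all add: card_lists_length_eq)
  ultimately have card: "real (card {xs. set xs \<subseteq> {1..n} \<and> length xs = k \<and> v \<in> set xs})
      = real n ^ k - (real n - 1) ^ k"
    using n by (simp add: of_nat_diff power_mono)
  have "real n ^ k - real k * real n ^ k / real n = real n ^ k * (1 + real k * (- 1 / real n))"
    by (simp add: right_diff_distrib)
  also have "\<dots> \<le> real n ^ k * (1 + (- 1 / real n)) ^ k"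
    using n by (intro mult_left_mono Bernoulli_inequality) auto
  also have "\<dots> = (real n - 1) ^ k"
    using n by (simp flip: power_mult_distrib add: right_diff_distrib)
  finally show ?thesis unfolding card by linarith
qed

text \<open>
  At most \<open>k * n ^ (k - 1)\<close> based loops of length \<open>k\<close> pass through \<open>v\<close>, and the factor \<open>k\<close> cancels
  against the \<open>1 / k\<close> in the weight. What is left is a geometric series, whose sum, multiplied
  by the time \<open>n * t\<close>, is exactly the Poisson parameter of the offspring law.
\<close>

lemma emeasure_loops_through_le:
  assumes \<epsilon>: "0 < \<epsilon>" and v: "v \<in> {1..n}"
  shows "emeasure (loop_measure \<epsilon> n) {l \<in> DL n. v \<in> loop_support l} \<le> ennreal (1 / (real n * \<epsilon> * (\<epsilon> + 1)))"
proof -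
  have n: "0 < real n" using v by auto
  define r where "r = 1 / (\<epsilon> + 1)"
  have r: "0 < r" "r < 1" using \<epsilon> by (auto simp: r_def)
  let ?w = "based_weight \<epsilon> n"
  define X where "X k = {l \<in> DL n. v \<in> loop_support l \<and> (\<forall>xs\<in>l. length xs = k)}" for k
  \<comment> \<open>The index is shifted by 2, the minimal length of a loop.\<close>
  define b where "b k = r ^ k * (r ^ 2 / real n)" for k
  have UX: "\<Union>(X k) \<subseteq> {xs. set xs \<subseteq> {1..n} \<and> length xs = k \<and> v \<in> set xs}" for k
    using DL_subset loop_support_eq by (fastforce simp: X_def)
  have fin: "finite {xs. set xs \<subseteq> {1..n} \<and> length xs = k \<and> v \<in> set xs}" for k
    by (rule finite_subset[OF _ finite_lists_length_eq[of "{1..n}" k]]) auto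
  have em: "emeasure (loop_measure \<epsilon> n) (X (k + 2)) \<le> ennreal (b k)" for k
  proof -
    let ?k = "k + 2"
    have "finite (\<Union>(X ?k))" using UX fin finite_subset by blast
    then have finX: "finite (X ?k)" by (rule finite_UnionD)
    then have "emeasure (loop_measure \<epsilon> n) (X ?k) = (\<Sum>xs\<in>\<Union>(X ?k). ennreal (?w xs))"
      by (intro emeasure_loop_measure_finite) (auto simp: X_def)
    also have "\<dots> \<le> (\<Sum>xs\<in>{xs. set xs \<subseteq> {1..n} \<and> length xs = ?k \<and> v \<in> set xs}. ennreal (?w xs))"
      using UX fin by (intro sum_mono2) auto
    also have "\<dots> = ennreal (\<Sum>xs\<in>{xs. set xs \<subseteq> {1..n} \<and> length xs = ?k \<and> v \<in> set xs}. ?w xs)"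
      using \<epsilon> n by (intro sum_ennreal) (auto simp: based_weight_eq)
    also have "\<dots> \<le> ennreal (b k)"
    proof (intro ennreal_leI)
      have "(\<Sum>xs\<in>{xs. set xs \<subseteq> {1..n} \<and> length xs = ?k \<and> v \<in> set xs}. ?w xs)
         = real (card {xs. set xs \<subseteq> {1..n} \<and> length xs = ?k \<and> v \<in> set xs}) * ((r / real n) ^ ?k / real ?k)"
        by (simp add: based_weight_eq r_def mult.commute)
      also have "\<dots> \<le> (real ?k * real n ^ ?k / real n) * ((r / real n) ^ ?k / real ?k)"
        using n r by (intro mult_right_mono card_lists_through_le v) auto
      also have "\<dots> = r ^ ?k / real n" using n by (simp add: power_divide del: power_Suc power_add of_nat_add)
      also have "\<dots> = b k" by (simp add: b_def power_add power2_eq_square)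
      finally show "(\<Sum>xs\<in>{xs. set xs \<subseteq> {1..n} \<and> length xs = ?k \<and> v \<in> set xs}. ?w xs) \<le> b k" .
    qed
    finally show ?thesis .
  qed
  have "{l \<in> DL n. v \<in> loop_support l} = (\<Union>k. X (k + 2))"
  proof (intro equalityI subsetI)
    fix l assume l: "l \<in> {l \<in> DL n. v \<in> loop_support l}"
    then obtain xs where xs: "xs \<in> l" using DL_nonempty by blast
    have "\<forall>ys\<in>l. length ys = length xs" using l xs DL_same_length_set(1) by blast
    then have "l \<in> X (length xs)" using l by (simp add: X_def)
    moreover have "2 \<le> length xs" using DL_subset[of l n] l xs by blast
    then have "length xs = (length xs - 2) + 2" by simp
    ultimately have "l \<in> X ((length xs - 2) + 2)" by metis
    then show "l \<in> (\<Union>k. X (k + 2))" by blast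
  qed (auto simp: X_def)
  then have "emeasure (loop_measure \<epsilon> n) {l \<in> DL n. v \<in> loop_support l} = emeasure (loop_measure \<epsilon> n) (\<Union>k. X (k + 2))"
    by simp
  also have "\<dots> \<le> (\<Sum>k. emeasure (loop_measure \<epsilon> n) (X (k + 2)))"
    by (intro emeasure_subadditive_countably) (auto simp: X_def sets_loop_measure)
  also have "\<dots> \<le> (\<Sum>k. ennreal (b k))"
    using em by (intro suminf_le) (auto intro: summableI)
  also have "\<dots> = ennreal (\<Sum>k. b k)"
    using r n by (intro suminf_ennreal2) (auto simp: b_def intro!: summable_mult2 summable_geometric)
  also have "(\<Sum>k. b k) = 1 / (real n * \<epsilon> * (\<epsilon> + 1))"
  proof -
    have "b = (\<lambda>k. r ^ k * (r ^ 2 / real n))" by (rule ext) (rule b_def)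
    moreover have "(\<lambda>k. r ^ k * (r ^ 2 / real n)) sums (1 / (1 - r) * (r ^ 2 / real n))"
      using r by (intro sums_mult2 geometric_sums) auto
    ultimately have "(\<Sum>k. b k) = 1 / (1 - r) * (r ^ 2 / real n)" using sums_unique by metis
    also have "\<dots> = 1 / (real n * \<epsilon> * (\<epsilon> + 1))"
    proof -
      have nz: "\<epsilon> + 1 \<noteq> 0" using \<epsilon> by simp
      have "1 - r = \<epsilon> / (\<epsilon> + 1)" using nz by (simp add: r_def diff_divide_eq_iff)
      moreover have "r ^ 2 = 1 / ((\<epsilon> + 1) * (\<epsilon> + 1))" by (simp add: r_def power2_eq_square)
      ultimately show ?thesis using nz \<epsilon> n by (simp add: mult_ac)
    qed
    finally show ?thesis .
  qed
  finally show ?thesis .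
qed

lemma finite_measure_loop_measure:
  assumes "0 < \<epsilon>"
  shows "finite_measure (loop_measure \<epsilon> n)"
proof (rule finite_measureI)
  have "DL n \<subseteq> (\<Union>v\<in>{1..n}. {l \<in> DL n. v \<in> loop_support l})"
  proof
    fix l assume l: "l \<in> DL n"
    then obtain xs where xs: "xs \<in> l" using DL_nonempty by blast
    then have "set xs \<subseteq> {1..n}" "2 \<le> length xs" using DL_subset[OF l] by auto
    moreover from this have "hd xs \<in> set xs" by (intro hd_in_set) auto
    ultimately show "l \<in> (\<Union>v\<in>{1..n}. {l \<in> DL n. v \<in> loop_support l})"
      using l loop_support_eq[OF l xs] by blast
  qed
  then have "emeasure (loop_measure \<epsilon> n) (DL n) \<le>
      emeasure (loop_measure \<epsilon> n) (\<Union>v\<in>{1..n}. {l \<in> DL n. v \<in> loop_support l})"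
    by (intro emeasure_mono) (auto simp: sets_loop_measure)
  also have "\<dots> \<le> (\<Sum>v\<in>{1..n}. emeasure (loop_measure \<epsilon> n) {l \<in> DL n. v \<in> loop_support l})"
    by (intro emeasure_subadditive_finite) (auto simp: sets_loop_measure)
  also have "\<dots> \<le> (\<Sum>v\<in>{1..n}. ennreal (1 / (real n * \<epsilon> * (\<epsilon> + 1))))"
    by (intro sum_mono emeasure_loops_through_le assms)
  also have "\<dots> < \<infinity>" by (simp add: ennreal_mult_less_top of_nat_less_top)
  finally show "emeasure (loop_measure \<epsilon> n) (space (loop_measure \<epsilon> n)) \<noteq> \<infinity>"
    by (simp add: space_loop_measure)
qed

definition loops_with_support :: "nat \<Rightarrow> nat set \<Rightarrow> nat list set set" where
  "loops_with_support n S = {l \<in> DL n. loop_support l = S}"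

text \<open>
  Only the loops visiting each point of \<open>S\<close> exactly once are counted: there are \<open>(s + 1)!\<close> such based
  loops, each of weight \<open>p ^ (s + 1) / (s + 1)\<close> with \<open>p = 1 / (n * (\<epsilon> + 1))\<close>.
\<close>

lemma measure_loops_with_support_ge:
  assumes \<epsilon>: "0 < \<epsilon>" and S: "S \<subseteq> {1..n}" "card S = Suc s" "0 < s"
  shows "fact s * (1 / (real n * (\<epsilon> + 1))) ^ Suc s \<le> measure (loop_measure \<epsilon> n) (loops_with_support n S)"
proof -
  interpret finite_measure "loop_measure \<epsilon> n" using \<epsilon> by (rule finite_measure_loop_measure)
  let ?p = "1 / (real n * (\<epsilon> + 1))" and ?P = "permutations_of_set S"
  have finS: "finite S" using S by (intro card_ge_0_finite) simp
  have len: "length xs = Suc s" if "xs \<in> ?P" for xs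
    using that S distinct_card[of xs] by (auto simp: permutations_of_set_def)
  define X where "X = (\<lambda>xs. loop_rel n `` {xs}) ` ?P"
  have XD: "X \<subseteq> loops_with_support n S"
  proof
    fix l assume "l \<in> X"
    then obtain xs where xs: "xs \<in> ?P" "l = loop_rel n `` {xs}" by (auto simp: X_def)
    have "set xs = S" using xs by (auto simp: permutations_of_set_def)
    then have "l \<in> DL n" "xs \<in> l" using DL_class[of xs n] S len[OF xs(1)] xs(2) by auto
    then show "l \<in> loops_with_support n S"
      using \<open>set xs = S\<close> loop_support_eq[of l n xs] by (auto simp: loops_with_support_def)
  qed
  have XDL: "X \<subseteq> DL n" using XD by (auto simp: loops_with_support_def)
  have finX: "finite X" using finS by (auto simp: X_def)
  have sub: "?P \<subseteq> \<Union>X"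
  proof
    fix xs assume xs: "xs \<in> ?P"
    then have "set xs \<subseteq> {1..n}" using S by (auto simp: permutations_of_set_def)
    then show "xs \<in> \<Union>X" using DL_class(2)[of xs n] len[OF xs] S xs by (auto simp: X_def)
  qed
  have finU: "finite (\<Union>X)" using finX XDL finite_DL by blast
  have w0: "0 \<le> based_weight \<epsilon> n xs" for xs using \<epsilon> by (simp add: based_weight_eq)
  have "(\<Sum>xs\<in>?P. based_weight \<epsilon> n xs) = (\<Sum>xs\<in>?P. ?p ^ Suc s / real (Suc s))"
    using len by (intro sum.cong) (simp_all add: based_weight_eq)
  also have "\<dots> = fact (Suc s) * (?p ^ Suc s / real (Suc s))"
    using finS S by (simp del: power_Suc of_nat_Suc fact_Suc)
  also have "\<dots> = fact s * ?p ^ Suc s"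
    by (simp add: fact_Suc del: power_Suc of_nat_Suc)
  finally have "fact s * ?p ^ Suc s = (\<Sum>xs\<in>?P. based_weight \<epsilon> n xs)" ..
  then have "ennreal (fact s * ?p ^ Suc s) = (\<Sum>xs\<in>?P. ennreal (based_weight \<epsilon> n xs))"
    using w0 by (simp add: sum_ennreal)
  also have "\<dots> \<le> (\<Sum>xs\<in>\<Union>X. ennreal (based_weight \<epsilon> n xs))"
    using sub finU by (intro sum_mono2) auto
  also have "\<dots> = emeasure (loop_measure \<epsilon> n) X"
    using finX XDL by (rule emeasure_loop_measure_finite[symmetric])
  also have "\<dots> \<le> emeasure (loop_measure \<epsilon> n) (loops_with_support n S)"
    using XD by (intro emeasure_mono) (auto simp: sets_loop_measure loops_with_support_def)
  finally show ?thesis by (simp add: emeasure_eq_measure)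
qed

lemma sum_measure_loops_with_support_le:
  assumes \<epsilon>: "0 < \<epsilon>" and v: "v \<in> {1..n}"
  shows "(\<Sum>S\<in>{S \<in> Pow {1..n}. v \<in> S}. measure (loop_measure \<epsilon> n) (loops_with_support n S))
    \<le> 1 / (real n * \<epsilon> * (\<epsilon> + 1))"
proof -
  interpret finite_measure "loop_measure \<epsilon> n" using \<epsilon> by (rule finite_measure_loop_measure)
  have "(\<Sum>S\<in>{S \<in> Pow {1..n}. v \<in> S}. measure (loop_measure \<epsilon> n) (loops_with_support n S))
    = measure (loop_measure \<epsilon> n) (\<Union>S\<in>{S \<in> Pow {1..n}. v \<in> S}. loops_with_support n S)"
    by (intro finite_measure_finite_Union[symmetric])
       (auto simp: loops_with_support_def sets_loop_measure disjoint_family_on_def)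
  also have "\<dots> \<le> measure (loop_measure \<epsilon> n) {l \<in> DL n. v \<in> loop_support l}"
    by (intro finite_measure_mono) (auto simp: loops_with_support_def sets_loop_measure)
  also have "\<dots> \<le> 1 / (real n * \<epsilon> * (\<epsilon> + 1))"
    using emeasure_loops_through_le[OF \<epsilon> v] \<epsilon> by (simp add: emeasure_eq_measure)
  finally show ?thesis .
qed

lemma emeasure_loop_intensity:
  assumes "0 < \<epsilon>" "0 \<le> T" "X \<subseteq> DL n"
  shows "emeasure (loop_intensity \<epsilon> n) ({0..T} \<times> X) = ennreal T * emeasure (loop_measure \<epsilon> n) X"
    "{0..T} \<times> X \<in> sets (loop_intensity \<epsilon> n)"
proof -
  interpret finite_measure "loop_measure \<epsilon> n" using assms(1) by (rule finite_measure_loop_measure)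
  have T: "{0..T} \<in> sets (restrict_space lborel {0..})"
    by (auto simp: sets_restrict_space image_iff intro!: bexI[of _ "{0..T}"])
  have X: "X \<in> sets (loop_measure \<epsilon> n)" using assms by (simp add: sets_loop_measure)
  show "{0..T} \<times> X \<in> sets (loop_intensity \<epsilon> n)"
    unfolding loop_intensity_def using T X by simp
  have "emeasure (restrict_space lborel {0..}) {0..T} = ennreal T"
    using assms by (subst emeasure_restrict_space) auto
  then show "emeasure (loop_intensity \<epsilon> n) ({0..T} \<times> X) = ennreal T * emeasure (loop_measure \<epsilon> n) X"
    unfolding loop_intensity_def using T X by (simp add: emeasure_pair_measure_Times)
qed

section \<open>From loops to independent hyperedges\<close>

definition present_supports :: "nat \<Rightarrow> (real \<times> nat list set) measure \<Rightarrow> real \<Rightarrow> nat set set" where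
  "present_supports n D T = {S \<in> Pow {1..n}. 0 < emeasure D ({0..T} \<times> loops_with_support n S)}"

text \<open>
  The loops of a given support are countably many, so a positive number of points among all of them
  means a positive number of points on one of them.
\<close>

lemma present_supports_eq:
  assumes "0 < \<epsilon>" "0 \<le> T" and sets: "sets D = sets (loop_intensity \<epsilon> n)"
  shows "present_supports n D T = loop_support ` loops_upto n D T"
proof (intro equalityI subsetI)
  fix S assume "S \<in> present_supports n D T"
  then have pos: "0 < emeasure D ({0..T} \<times> loops_with_support n S)" by (simp add: present_supports_def)
  let ?L = "loops_with_support n S"
  have LD: "?L \<subseteq> DL n" by (auto simp: loops_with_support_def)
  have cL: "countable ?L" using LD countable_DL by (rule countable_subset)
  have "\<exists>l\<in>?L. 0 < emeasure D ({0..T} \<times> {l})"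
  proof (rule ccontr)
    assume "\<not> ?thesis"
    then have "{0..T} \<times> {l} \<in> null_sets D" if "l \<in> ?L" for l
      using that LD emeasure_loop_intensity(2)[OF assms(1,2), of "{l}" n] sets
      by (auto simp: null_sets_def not_less)
    then have "(\<Union>l\<in>?L. {0..T} \<times> {l}) \<in> null_sets D"
      using cL by (intro null_sets_UN') auto
    moreover have "(\<Union>l\<in>?L. {0..T} \<times> {l}) = {0..T} \<times> ?L" by auto
    ultimately show False using pos by (simp add: null_sets_def)
  qed
  then obtain l where l: "l \<in> ?L" "0 < emeasure D ({0..T} \<times> {l})" by blast
  then have "l \<in> loops_upto n D T" using LD by (auto simp: loops_upto_def)
  moreover have "S = loop_support l" using l by (simp add: loops_with_support_def)
  ultimately show "S \<in> loop_support ` loops_upto n D T" by blast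
next
  fix S assume "S \<in> loop_support ` loops_upto n D T"
  then obtain l where l: "l \<in> DL n" "0 < emeasure D ({0..T} \<times> {l})" "S = loop_support l"
    by (auto simp: loops_upto_def)
  have "0 < emeasure D ({0..T} \<times> {l})" by (rule l)
  also have "\<dots> \<le> emeasure D ({0..T} \<times> loops_with_support n S)"
    using l emeasure_loop_intensity(2)[OF assms(1,2), of "loops_with_support n S" n]
    by (intro emeasure_mono) (auto simp: sets loops_with_support_def)
  finally have pos: "0 < emeasure D ({0..T} \<times> loops_with_support n S)" .
  moreover have "S \<subseteq> {1..n}" using DL_subset[OF l(1)] l(3) unfolding loop_support_def by blast
  ultimately show "S \<in> present_supports n D T"
    by (simp add: present_supports_def)
qed

lemma based_loop_connected:
  assumes "i < length xs"
  shows "(xs ! 0, xs ! i) \<in> {(u, v). {u, v} \<in> based_loop_edges xs}\<^sup>*"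
  using assms
proof (induction i)
  case (Suc i)
  then have "{xs ! i, xs ! Suc i} \<in> based_loop_edges xs"
    by (auto simp: based_loop_edges_def intro!: exI[of _ i])
  with Suc show ?case by (auto intro: rtrancl_into_rtrancl)
qed simp

text \<open>
  Every edge of the graph lies in the support of a loop, and following a loop links all the vertices
  of its support.
\<close>

lemma component_eq_reach:
  assumes x: "x \<in> {1..n}"
  shows "component n D T x = reach (loop_support ` loops_upto n D T) {x}"
proof -
  let ?E = "{(u, v). {u, v} \<in> graph_edges n D T}" and ?H = "loop_support ` loops_upto n D T"
  have DL: "l \<in> DL n" if "l \<in> loops_upto n D T" for l using that by (simp add: loops_upto_def)
  have sub: "?E \<subseteq> hyper_adj ?H"
  proof clarify
    fix u v assume "{u, v} \<in> graph_edges n D T"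
    then obtain l xs where l: "l \<in> loops_upto n D T" "xs \<in> l" "{u, v} \<in> based_loop_edges xs"
      by (auto simp: graph_edges_def)
    then obtain i where i: "i < length xs" "{u, v} = {xs ! i, xs ! (Suc i mod length xs)}"
      by (auto simp: based_loop_edges_def)
    then have "Suc i mod length xs < length xs" by (intro mod_less_divisor) auto
    then have "{u, v} \<subseteq> set xs" unfolding i(2) using i(1) by (auto intro: nth_mem)
    then have "{u, v} \<subseteq> loop_support l" using loop_support_eq[OF DL[OF l(1)] l(2)] by blast
    then show "(u, v) \<in> hyper_adj ?H" using l(1) by (auto simp: hyper_adj_def)
  qed
  have symE: "sym ?E" by (auto simp: sym_def insert_commute)
  have sup: "hyper_adj ?H \<subseteq> ?E\<^sup>*"
  proof clarify
    fix u v assume "(u, v) \<in> hyper_adj ?H"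
    then obtain l where l: "l \<in> loops_upto n D T" "u \<in> loop_support l" "v \<in> loop_support l"
      by (auto simp: hyper_adj_def)
    obtain xs where xs: "xs \<in> l" using DL_nonempty[OF DL[OF l(1)]] by blast
    have "based_loop_edges xs \<subseteq> graph_edges n D T" using l(1) xs by (auto simp: graph_edges_def)
    then have mono: "{(u, v). {u, v} \<in> based_loop_edges xs}\<^sup>* \<subseteq> ?E\<^sup>*"
      by (intro rtrancl_mono) auto
    have conn: "(xs ! 0, w) \<in> ?E\<^sup>*" if "w \<in> loop_support l" for w
      using that loop_support_eq[OF DL[OF l(1)] xs] based_loop_connected[of _ xs] mono
      by (auto simp: in_set_conv_nth)
    have "(u, xs ! 0) \<in> ?E\<^sup>*"
      using conn[OF l(2)] sym_rtrancl[OF symE] by (meson symD)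
    then show "(u, v) \<in> ?E\<^sup>*" using conn[OF l(3)] by (rule rtrancl_trans)
  qed
  have "?E\<^sup>* = (hyper_adj ?H)\<^sup>*" using rtrancl_subset[OF sub sup] by simp
  moreover have "reach ?H {x} \<subseteq> {1..n}"
    using x DL DL_subset unfolding loop_support_def by (intro reach_bounded) blast+
  ultimately show ?thesis unfolding component_def reach_def by blast
qed

text \<open>
  Disjoint sets carry independent Poisson numbers of points, and a set of intensity \<open>\<theta>\<close> is empty with
  probability \<open>exp (- \<theta>)\<close>.
\<close>

lemma ppp_random_subset:
  fixes C :: "'e \<Rightarrow> 'a set"
  assumes ppp: "poisson_point_process M I N"
    and fin: "finite L" and C: "\<And>e. e \<in> L \<Longrightarrow> C e \<in> sets I" "\<And>e. e \<in> L \<Longrightarrow> emeasure I (C e) < \<infinity>"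
    and disj: "disjoint_family_on C L"
  shows "measure M {\<omega> \<in> space M. {e \<in> L. 0 < emeasure (N \<omega>) (C e)} \<in> A} =
     measure_pmf.prob (random_subset (\<lambda>e. measure I (C e)) L) A"
proof -
  interpret prob_space M using ppp by (simp add: poisson_point_process_def)
  let ?\<theta> = "\<lambda>e. measure I (C e)" and ?H = "\<lambda>\<omega>. {e \<in> L. 0 < emeasure (N \<omega>) (C e)}"
  have meas[measurable]: "(\<lambda>\<omega>. emeasure (N \<omega>) (C e)) \<in> borel_measurable M" if "e \<in> L" for e
    using ppp C(1)[OF that] unfolding poisson_point_process_def by blast
  have zero: "prob {\<omega> \<in> space M. emeasure (N \<omega>) (C e) = 0} = exp (- ?\<theta> e)" if "e \<in> L" for e
  proof -
    have "prob {\<omega> \<in> space M. emeasure (N \<omega>) (C e) = of_nat 0} = ?\<theta> e ^ 0 / fact 0 * exp (- ?\<theta> e)"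
      using ppp C(1)[OF that] C(2)[OF that] unfolding poisson_point_process_def by blast
    then show ?thesis by simp
  qed
  have pos: "prob {\<omega> \<in> space M. 0 < emeasure (N \<omega>) (C e)} = 1 - exp (- ?\<theta> e)" if "e \<in> L" for e
  proof -
    have "{\<omega> \<in> space M. 0 < emeasure (N \<omega>) (C e)} = space M - {\<omega> \<in> space M. emeasure (N \<omega>) (C e) = 0}"
      by (auto simp: zero_less_iff_neq_zero)
    then show ?thesis using zero[OF that] meas[OF that] by (simp add: prob_compl)
  qed
  \<comment> \<open>The independence property is stated for families indexed by natural numbers.\<close>
  obtain b where b: "bij_betw b {..<card L} L"
    using ex_bij_betw_nat_finite[OF fin] by (auto simp: atLeast0LessThan)
  have bL: "b j \<in> L" if "j < card L" for j using b that by (auto simp: bij_betw_def)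
  have ind: "indep_vars (\<lambda>_. borel) (\<lambda>j \<omega>. emeasure (N \<omega>) (C (b j))) {..<card L}"
  proof -
    have "disjoint_family_on (\<lambda>j. C (b j)) {..<card L}"
      using disj b bL unfolding disjoint_family_on_def bij_betw_def inj_on_def by (meson lessThan_iff)
    then show ?thesis
      using ppp C bL unfolding poisson_point_process_def by auto
  qed
  have atom: "prob {\<omega> \<in> space M. ?H \<omega> = Q} = pmf (random_subset ?\<theta> L) Q" if Q: "Q \<subseteq> L" for Q
  proof (cases "L = {}")
    case True
    then show ?thesis using Q pmf_random_subset[of L Q ?\<theta>] by (simp add: prob_space)
  next
    case False
    let ?X = "\<lambda>j \<omega>. emeasure (N \<omega>) (C (b j))"
    let ?A = "\<lambda>e. if e \<in> Q then {0<..} else {0 :: ennreal}"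
    have Leq: "L = b ` {..<card L}" and inj: "inj_on b {..<card L}" using b by (auto simp: bij_betw_def)
    have ne: "{..<card L} \<noteq> {}" using False by (subst (asm) Leq) simp
    have "{\<omega> \<in> space M. ?H \<omega> = Q} = {\<omega> \<in> space M. \<forall>e\<in>L. emeasure (N \<omega>) (C e) \<in> ?A e}"
      using Q by (auto simp: zero_less_iff_neq_zero split: if_splits)
    also have "\<dots> = (\<Inter>j\<in>{..<card L}. ?X j -` ?A (b j) \<inter> space M)"
    proof -
      have "(\<forall>e\<in>L. emeasure (N \<omega>) (C e) \<in> ?A e) \<longleftrightarrow> (\<forall>j\<in>{..<card L}. ?X j \<omega> \<in> ?A (b j))" for \<omega>
        by (subst Leq) blast
      then show ?thesis using ne by auto
    qed
    also have "prob \<dots> = (\<Prod>j\<in>{..<card L}. prob (?X j -` ?A (b j) \<inter> space M))"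
      by (rule indep_varsD_finite[OF ind ne]) auto
    also have "\<dots> = (\<Prod>e\<in>L. prob ((\<lambda>\<omega>. emeasure (N \<omega>) (C e)) -` ?A e \<inter> space M))"
      by (rule prod.reindex_bij_betw[OF b])
    also have "\<dots> = (\<Prod>e\<in>L. if e \<in> Q then 1 - exp (- ?\<theta> e) else exp (- ?\<theta> e))"
    proof (intro prod.cong refl)
      fix e assume e: "e \<in> L"
      show "prob ((\<lambda>\<omega>. emeasure (N \<omega>) (C e)) -` ?A e \<inter> space M)
        = (if e \<in> Q then 1 - exp (- ?\<theta> e) else exp (- ?\<theta> e))"
        using zero[OF e] pos[OF e] by (auto simp: vimage_def Int_def conj_commute)
    qed
    also have "\<dots> = (\<Prod>e\<in>Q. 1 - exp (- ?\<theta> e)) * (\<Prod>e\<in>L-Q. exp (- ?\<theta> e))"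
      using fin Q by (subst prod.If_cases) (auto simp: Int_absorb1 Diff_eq)
    also have "\<dots> = pmf (random_subset ?\<theta> L) Q"
      using fin Q by (intro pmf_random_subset[symmetric]) auto
    finally show ?thesis .
  qed
  have ev: "{\<omega> \<in> space M. ?H \<omega> = Q} \<in> events" if "Q \<subseteq> L" for Q
  proof -
    have "{\<omega> \<in> space M. ?H \<omega> = Q} = {\<omega> \<in> space M. \<forall>e\<in>L. (0 < emeasure (N \<omega>) (C e)) = (e \<in> Q)}"
      using that by auto
    also have "\<dots> \<in> events" using fin meas by (intro sets.sets_Collect_finite_All) measurable
    finally show ?thesis .
  qed
  have "{\<omega> \<in> space M. ?H \<omega> \<in> A} = (\<Union>Q\<in>A \<inter> Pow L. {\<omega> \<in> space M. ?H \<omega> = Q})" by blast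
  also have "prob \<dots> = (\<Sum>Q\<in>A \<inter> Pow L. prob {\<omega> \<in> space M. ?H \<omega> = Q})"
  proof (intro finite_measure_finite_Union)
    show "(\<lambda>Q. {\<omega> \<in> space M. ?H \<omega> = Q}) ` (A \<inter> Pow L) \<subseteq> events" using ev by blast
  qed (use fin in \<open>auto simp: disjoint_family_on_def\<close>)
  also have "\<dots> = (\<Sum>Q\<in>A \<inter> Pow L. pmf (random_subset ?\<theta> L) Q)"
    using atom by (intro sum.cong) auto
  also have "\<dots> = measure_pmf.prob (random_subset ?\<theta> L) (A \<inter> Pow L)"
    using fin by (intro measure_measure_pmf_finite[symmetric]) auto
  also have "\<dots> = measure_pmf.prob (random_subset ?\<theta> L) A"
    using set_random_subset[OF fin, of ?\<theta>]
    by (intro measure_pmf.finite_measure_eq_AE) (auto simp: AE_measure_pmf_iff)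
  finally show ?thesis .
qed

definition support_intensity :: "real \<Rightarrow> nat \<Rightarrow> real \<Rightarrow> nat set \<Rightarrow> real" where
  "support_intensity \<epsilon> n T S = measure (loop_intensity \<epsilon> n) ({0..T} \<times> loops_with_support n S)"

lemma support_intensity_eq:
  assumes "0 < \<epsilon>" "0 \<le> T"
  shows "support_intensity \<epsilon> n T S = T * measure (loop_measure \<epsilon> n) (loops_with_support n S)"
  unfolding support_intensity_def
  using assms emeasure_loop_intensity(1)[OF assms, of "loops_with_support n S" n]
  by (simp add: measure_def enn2real_mult loops_with_support_def subset_iff)

lemma prob_component_le:
  assumes "0 < \<epsilon>" "0 \<le> T" "x \<in> {1..n}" and ppp: "poisson_point_process M (loop_intensity \<epsilon> n) DP"
  shows "measure M {\<omega> \<in> space M. card (component n (DP \<omega>) T x) \<le> m} =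
    measure_pmf.prob (random_subset (support_intensity \<epsilon> n T) (Pow {1..n})) {H. card (reach H {x}) \<le> m}"
proof -
  interpret finite_measure "loop_measure \<epsilon> n" using assms(1) by (rule finite_measure_loop_measure)
  have sub: "loops_with_support n S \<subseteq> DL n" for S by (auto simp: loops_with_support_def)
  have "component n (DP \<omega>) T x = reach (present_supports n (DP \<omega>) T) {x}" if "\<omega> \<in> space M" for \<omega>
    using ppp that assms component_eq_reach present_supports_eq[OF assms(1,2)]
    by (simp add: poisson_point_process_def)
  then have "{\<omega> \<in> space M. card (component n (DP \<omega>) T x) \<le> m} =
      {\<omega> \<in> space M. present_supports n (DP \<omega>) T \<in> {H. card (reach H {x}) \<le> m}}"
    by auto
  also have "measure M \<dots> = measure_pmf.prob (random_subset (support_intensity \<epsilon> n T) (Pow {1..n})) {H. card (reach H {x}) \<le> m}"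
    unfolding present_supports_def support_intensity_def[abs_def]
  proof (rule ppp_random_subset[OF ppp])
    fix S
    show "{0..T} \<times> loops_with_support n S \<in> sets (loop_intensity \<epsilon> n)"
      by (rule emeasure_loop_intensity(2)[OF assms(1,2) sub])
    show "emeasure (loop_intensity \<epsilon> n) ({0..T} \<times> loops_with_support n S) < \<infinity>"
      unfolding emeasure_loop_intensity(1)[OF assms(1,2) sub]
      unfolding emeasure_eq_measure by (simp flip: ennreal_mult'')
  qed (auto simp: disjoint_family_on_def loops_with_support_def)
  finally show ?thesis .
qed

section \<open>Comparison of the component with the total progeny\<close>

text \<open>
  The rate of jumps of size \<open>k\<close> of the offspring law is \<open>\<Lambda> * (1 - q) ^ (k - 1) * q\<close> with
  \<open>\<Lambda> = t / (\<epsilon> * (\<epsilon> + 1))\<close> and \<open>q = \<epsilon> / (\<epsilon> + 1)\<close>, that is, \<open>t / (\<epsilon> + 1) ^ (k + 1)\<close>.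
\<close>

lemma hypergraph_near_branching_loops:
  assumes \<epsilon>: "0 < \<epsilon>" and t: "0 < t"
  shows "hypergraph_near_branching {1..n} (support_intensity \<epsilon> n (real n * t)) (offspring_pmf \<epsilon> t)
    (t / (\<epsilon> * (\<epsilon> + 1))) (\<lambda>k. t * (1 / (\<epsilon> + 1)) ^ Suc k)"
proof
  let ?\<Lambda> = "t / (\<epsilon> * (\<epsilon> + 1))" and ?q = "\<epsilon> / (\<epsilon> + 1)" and ?r = "1 / (\<epsilon> + 1)"
  have \<Lambda>: "0 < ?\<Lambda>" using \<epsilon> t by simp
  have q: "0 < ?q" "?q < 1" using \<epsilon> by auto
  have rq: "1 - ?q = ?r" using \<epsilon> by (simp add: field_simps)
  have T: "0 \<le> real n * t" using t by simp
  note \<theta>_eq = support_intensity_eq[OF \<epsilon> T]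
  show "finite {1..n}" by simp
  show "0 \<le> support_intensity \<epsilon> n (real n * t) e" for e by (simp add: support_intensity_def)
  show "(\<Sum>e\<in>{e \<in> Pow {1..n}. v \<in> e}. support_intensity \<epsilon> n (real n * t) e) \<le> ?\<Lambda>" if v: "v \<in> {1..n}" for v
  proof -
    have n: "0 < real n" using v by auto
    have "(\<Sum>e\<in>{e \<in> Pow {1..n}. v \<in> e}. support_intensity \<epsilon> n (real n * t) e)
      = real n * t * (\<Sum>e\<in>{e \<in> Pow {1..n}. v \<in> e}. measure (loop_measure \<epsilon> n) (loops_with_support n e))"
      unfolding \<theta>_eq sum_distrib_left ..
    also have "\<dots> \<le> real n * t * (1 / (real n * \<epsilon> * (\<epsilon> + 1)))"
      by (intro mult_left_mono sum_measure_loops_with_support_le \<epsilon> v T)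
    also have "\<dots> = ?\<Lambda>" using n by (simp add: mult.assoc)
    finally show ?thesis .
  qed
  show "fact (card B) * (t * ?r ^ Suc (card B) / real (card {1..n}) ^ card B)
      \<le> support_intensity \<epsilon> n (real n * t) (insert v B)"
    if "v \<in> {1..n}" "B \<subseteq> {1..n}" "v \<notin> B" "B \<noteq> {}" for v B
  proof -
    have n: "0 < real n" using that by auto
    have finB: "finite B" using that(2) by (rule finite_subset) simp
    have "real n * t * (fact (card B) * (1 / (real n * (\<epsilon> + 1))) ^ Suc (card B)) \<le> support_intensity \<epsilon> n (real n * t) (insert v B)"
      unfolding \<theta>_eq using that finB
      by (intro mult_left_mono measure_loops_with_support_ge \<epsilon> T) (auto simp: card_gt_0_iff)
    moreover have "(1 / (real n * (\<epsilon> + 1))) ^ Suc (card B) = ?r ^ Suc (card B) / (real n * real n ^ card B)"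
      by (simp add: power_divide power_mult_distrib)
    ultimately show ?thesis using n by (simp add: mult_ac del: power_Suc)
  qed
  show "0 \<le> t * ?r ^ Suc k" for k using \<epsilon> t by simp
  show "pmf (offspring_pmf \<epsilon> t) 0 = exp (- ?\<Lambda>)"
    unfolding offspring_pmf_def using \<Lambda> q by (intro pmf_cpois_0 pmf_geometric_pos) auto
  show "real (Suc j) * pmf (offspring_pmf \<epsilon> t) (Suc j) =
      (\<Sum>i\<le>j. real (Suc i) * (t * ?r ^ Suc (Suc i)) * pmf (offspring_pmf \<epsilon> t) (j - i))" for j
  proof -
    have "?\<Lambda> * pmf (geometric_pos_pmf ?q) (Suc i) = t * ?r ^ Suc (Suc i)" for i
      using \<epsilon> q by (subst pmf_geometric_pos) (simp_all add: rq)
    then show ?thesis unfolding offspring_pmf_def pmf_cpois_Suc[OF \<Lambda>] by (simp only:)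
  qed
  show "integrable (measure_pmf (offspring_pmf \<epsilon> t)) (\<lambda>j. real j ^ 2)"
    unfolding offspring_pmf_def using \<Lambda> q by (rule cpois_geometric_square_integrable)
qed

lemma ereal_of_enat_le_iff:
  assumes "0 \<le> k"
  shows "ereal_of_enat N \<le> ereal k \<longleftrightarrow> N \<le> enat (nat \<lfloor>k\<rfloor>)"
  using assms by (cases N) (auto simp: le_nat_iff le_floor_iff)

theorem theorem1p1:
  fixes \<epsilon> t :: real
    and k :: "nat \<Rightarrow> real"
    and x :: "nat \<Rightarrow> nat"
    and M :: "nat \<Rightarrow> 'w measure"
    and DP :: "nat \<Rightarrow> 'w \<Rightarrow> (real \<times> nat list set) measure"
  assumes "\<epsilon> > 0" and "t > 0"
    and "\<And>n. n \<ge> 1 \<Longrightarrow> k n > 0"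
    and "\<And>n. n \<ge> 1 \<Longrightarrow> x n \<in> {1..n}"
    and "\<And>n. n \<ge> 1 \<Longrightarrow> poisson_point_process (M n) (loop_intensity \<epsilon> n) (DP n)"
  shows "(\<lambda>n. measure (M n)
                {\<omega> \<in> space (M n). real (card (component n (DP n \<omega>) (real n * t) (x n))) \<le> k n}
            - measure (gw_space (offspring_pmf \<epsilon> t))
                {\<xi> \<in> space (gw_space (offspring_pmf \<epsilon> t)).
                   ereal_of_enat (gw_total 1 \<xi>) \<le> ereal (k n)})
         \<in> O(\<lambda>n. (k n)\<^sup>2 / real n)"
proof (rule bigoI)
  let ?\<nu> = "offspring_pmf \<epsilon> t"
  define c where "c = 2 * measure_pmf.expectation ?\<nu> (\<lambda>j. real j ^ 2)"
  have c0: "0 \<le> c" unfolding c_def by (intro mult_nonneg_nonneg integral_nonneg_AE) auto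
  show "\<forall>\<^sub>F n in sequentially. norm (measure (M n)
        {\<omega> \<in> space (M n). real (card (component n (DP n \<omega>) (real n * t) (x n))) \<le> k n}
      - measure (gw_space ?\<nu>) {\<xi> \<in> space (gw_space ?\<nu>). ereal_of_enat (gw_total 1 \<xi>) \<le> ereal (k n)})
      \<le> c * norm ((k n)\<^sup>2 / real n)"
    using eventually_ge_at_top[of 1]
  proof eventually_elim
    case (elim n)
    define m where "m = nat \<lfloor>k n\<rfloor>"
    have k0: "0 < k n" using assms elim by blast
    have le_m: "real j \<le> k n \<longleftrightarrow> j \<le> m" for j
      using k0 by (auto simp: m_def le_nat_iff le_floor_iff)
    have mk: "real m \<le> k n" using le_m by blast
    interpret hypergraph_near_branching "{1..n}" "support_intensity \<epsilon> n (real n * t)" ?\<nu>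
        "t / (\<epsilon> * (\<epsilon> + 1))" "\<lambda>k. t * (1 / (\<epsilon> + 1)) ^ Suc k"
      using assms by (intro hypergraph_near_branching_loops)
    have xn: "x n \<in> {1..n}" using assms elim by blast
    have comp: "measure (M n) {\<omega> \<in> space (M n). real (card (component n (DP n \<omega>) (real n * t) (x n))) \<le> k n}
       = measure_pmf.prob (random_subset (support_intensity \<epsilon> n (real n * t)) (Pow {1..n}))
           {H. card (reach H {x n}) \<le> m}"
      unfolding le_m using assms elim xn by (intro prob_component_le) auto
    have gw: "measure (gw_space ?\<nu>) {\<xi> \<in> space (gw_space ?\<nu>). ereal_of_enat (gw_total 1 \<xi>) \<le> ereal (k n)}
       = total_progeny_le ?\<nu> m (card {x n})"
      using k0 by (simp add: ereal_of_enat_le_iff prob_gw_total flip: m_def)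
    \<comment> \<open>The maximum makes \<open>K\<close> at least 1 when \<open>m = 0\<close>; the bound is then 0.\<close>
    have "norm (measure (M n)
        {\<omega> \<in> space (M n). real (card (component n (DP n \<omega>) (real n * t) (x n))) \<le> k n}
      - measure (gw_space ?\<nu>) {\<xi> \<in> space (gw_space ?\<nu>). ereal_of_enat (gw_total 1 \<xi>) \<le> ereal (k n)})
      \<le> real m * (real (max 1 m) * c / real (card {1..n}))"
      unfolding comp gw real_norm_def c_def using xn by (intro prob_reach_close) auto
    also have "\<dots> = c * (real m)\<^sup>2 / real n"
      by (cases "m = 0") (auto simp: max_def power2_eq_square)
    also have "\<dots> \<le> c * (k n)\<^sup>2 / real n"
      using mk c0 by (intro divide_right_mono mult_left_mono power_mono) auto
    finally show ?case by simp
  qed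
qed

end
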